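(* If $\mathcal{V}$ is a congruence modular variety, then $\mathcal{V}$ has an $n$-difference term $c_n(x,y,z)$ for each $n\geq 2$.
   Context: Higher commutator. For congruences $\alpha_1,\dots,\alpha_n,\delta$ of an algebra $\mathbf{A}$ ($n\ge 2$), $C(\alpha_1,\dots,\alpha_n;\delta)$ holds if for all polynomials $f(\mathbf{x}_1,\dots,\mathbf{x}_n)$ of $\mathbf A$ in $n$ blocks of variables and all tuples with $\mathbf{a}_i\equiv_{\alpha_i}\mathbf{b}_i$ (coordinatewise, $i\le n$): if $f(\mathbf{z}_1,\dots,\mathbf{z}_{n-1},\mathbf{a}_n)\equiv_\delta f(\mathbf{z}_1,\dots,\mathbf{z}_{n-1},\mathbf{b}_n)$ for every $(\mathbf{z}_1,\dots,\mathbf{z}_{n-1})\in\prod_{i<n}\{\mathbf{a}_i,\mathbf{b}_i\}\setminus\{(\mathbf{b}_1,\dots,\mathbf{b}_{n-1})\}$, then $f(\mathbf{b}_1,\dots,\mathbf{b}_{n-1},\mathbf{a}_n)\equiv_\delta f(\mathbf{b}_1,\dots,\mathbf{b}_{n-1},\mathbf{b}_n)$. $[\alpha_1,\dots,\alpha_n]$ is the least $\delta$ with $C(\alpha_1,\dots,\alpha_n;\delta)$, and $[\theta,\dots,\theta]_n$ is the commutator with $n$ entries $\theta$. An $n$-difference term for a variety $\mathcal{V}$ is a term $c(x,y,z)$ such that for all $\mathbf{A}\in\mathcal{V}$ and $a,b\in A$, with $\theta=\theta(a,b)$ the congruence generated by $(a,b)$, we have $c(a,b,b)\;[\theta,\dots,\theta]_n\;a$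 and $c(b,b,a)=a$. *)

theory Defs
  imports Main
begin

section \<open>Terms and algebras over a finitary signature\<close>

text \<open>A signature is an arity function on a type of operation symbols.\<close>

datatype ('f, vars: 'v) trm = Var 'v | Fun 'f "('f, 'v) trm list"

fun wf_trm :: "('f \<Rightarrow> nat) \<Rightarrow> ('f, 'v) trm \<Rightarrow> bool" where
  "wf_trm ar (Var v) \<longleftrightarrow> True"
| "wf_trm ar (Fun f ts) \<longleftrightarrow> length ts = ar f \<and> (\<forall>t\<in>set ts. wf_trm ar t)"

record ('f, 'a) ualg =
  carrier :: "'a set"
  oper :: "'f \<Rightarrow> 'a list \<Rightarrow> 'a"

definition is_algebra :: "('f \<Rightarrow> nat) \<Rightarrow> ('f, 'a) ualg \<Rightarrow> bool" where
  "is_algebra ar A \<longleftrightarrow> carrier A \<noteq> {} \<and>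
     (\<forall>f xs. length xs = ar f \<and> set xs \<subseteq> carrier A \<longrightarrow> oper A f xs \<in> carrier A)"

fun eval_trm :: "('f, 'a) ualg \<Rightarrow> ('v \<Rightarrow> 'a) \<Rightarrow> ('f, 'v) trm \<Rightarrow> 'a" where
  "eval_trm A \<sigma> (Var v) = \<sigma> v"
| "eval_trm A \<sigma> (Fun f ts) = oper A f (map (eval_trm A \<sigma>) ts)"

text \<open>The variety axiomatised by a set \<open>E\<close> of identities (pairs of terms). A class of algebras
  of all possible carriers is not an object of HOL; \<open>variety ar E\<close> is polymorphic in the type
  \<open>'a\<close> that the carriers are subsets of, and a statement about a whole variety has to name the
  types it speaks about. If \<open>'a\<close> is infinite and \<open>'f\<close> injects into \<open>'a\<close>, then all countably
  generated algebras of the variety, in particular its free algebras of finite and of countable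
  rank, occur at type \<open>'a\<close> up to isomorphism. The existence of one term that works for the
  algebras at every type is expressed by: some term works at one such type \<open>'u\<close>, and every
  term that works at \<open>'u\<close> works at an arbitrary type \<open>'v\<close>.\<close>

definition variety ::
  "('f \<Rightarrow> nat) \<Rightarrow> (('f, nat) trm \<times> ('f, nat) trm) set \<Rightarrow> ('f, 'a) ualg set" where
  "variety ar E = {A. is_algebra ar A \<and>
     (\<forall>(s, t)\<in>E. \<forall>\<sigma>. range \<sigma> \<subseteq> carrier A \<longrightarrow> eval_trm A \<sigma> s = eval_trm A \<sigma> t)}"


section \<open>Congruences and congruence modularity\<close>

definition congruences :: "('f \<Rightarrow> nat) \<Rightarrow> ('f, 'a) ualg \<Rightarrow> 'a rel set" where
  "congruences ar A = {\<theta>. equiv (carrier A) \<theta> \<and>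
     (\<forall>f xs ys. length xs = ar f \<and> list_all2 (\<lambda>x y. (x, y) \<in> \<theta>) xs ys \<longrightarrow>
        (oper A f xs, oper A f ys) \<in> \<theta>)}"

definition cong_gen :: "('f \<Rightarrow> nat) \<Rightarrow> ('f, 'a) ualg \<Rightarrow> 'a rel \<Rightarrow> 'a rel" where
  "cong_gen ar A R = \<Inter>{\<theta> \<in> congruences ar A. R \<subseteq> \<theta>}"

definition cong_join :: "('f \<Rightarrow> nat) \<Rightarrow> ('f, 'a) ualg \<Rightarrow> 'a rel \<Rightarrow> 'a rel \<Rightarrow> 'a rel" where
  "cong_join ar A \<alpha> \<beta> = cong_gen ar A (\<alpha> \<union> \<beta>)"

definition congruence_modular :: "('f \<Rightarrow> nat) \<Rightarrow> ('f, 'a) ualg set \<Rightarrow> bool" where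
  "congruence_modular ar V \<longleftrightarrow> (\<forall>A\<in>V.
     \<forall>\<alpha>\<in>congruences ar A. \<forall>\<beta>\<in>congruences ar A. \<forall>\<gamma>\<in>congruences ar A.
       \<alpha> \<subseteq> \<gamma> \<longrightarrow> cong_join ar A \<alpha> (\<beta> \<inter> \<gamma>) = cong_join ar A \<alpha> \<beta> \<inter> \<gamma>)"


section \<open>Polynomials and the higher commutator\<close>

text \<open>A polynomial of \<open>A\<close> in \<open>n\<close> blocks of variables, the \<open>i\<close>-th block having \<open>k i\<close> variables:
  a term whose variables are either block variables \<open>Inl (i, j)\<close> (the \<open>j\<close>-th variable of
  block \<open>i\<close>) or parameters \<open>Inr c\<close> with \<open>c\<close> in the carrier. Blocks are numbered from \<open>0\<close>.\<close>

definition polynomials ::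
  "('f \<Rightarrow> nat) \<Rightarrow> ('f, 'a) ualg \<Rightarrow> nat \<Rightarrow> (nat \<Rightarrow> nat) \<Rightarrow> ('f, (nat \<times> nat) + 'a) trm set" where
  "polynomials ar A n k = {p. wf_trm ar p \<and>
     vars p \<subseteq> Inl ` {(i, j). i < n \<and> j < k i} \<union> Inr ` carrier A}"

definition eval_poly ::
  "('f, 'a) ualg \<Rightarrow> ('f, (nat \<times> nat) + 'a) trm \<Rightarrow> (nat \<Rightarrow> nat \<Rightarrow> 'a) \<Rightarrow> 'a" where
  "eval_poly A p x = eval_trm A (case_sum (\<lambda>(i, j). x i j) id) p"

definition corner ::
  "(nat \<Rightarrow> nat \<Rightarrow> 'a) \<Rightarrow> (nat \<Rightarrow> nat \<Rightarrow> 'a) \<Rightarrow> nat set \<Rightarrow> nat \<Rightarrow> nat \<Rightarrow> 'a" where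
  "corner a b S i = (if i \<in> S then b i else a i)"

text \<open>The relation \<open>C(\<alpha>\<^sub>1,\<dots>,\<alpha>\<^sub>n;\<delta>)\<close>, with \<open>\<alpha>s = [\<alpha>\<^sub>1,\<dots>,\<alpha>\<^sub>n]\<close>.
  A choice of an entry from each of \<open>{a\<^sub>i, b\<^sub>i}\<close>, \<open>i < n\<close>, is encoded by the set \<open>S\<close> of those
  positions at which \<open>b\<^sub>i\<close> is taken, and the hypothesis ranges over all choices other than
  the all-\<open>b\<close> one. It has to be indexed by choices and not by the resulting tuples:
  removing the tuple \<open>(b\<^sub>1,\<dots>,b\<^sub>n\<^sub>-\<^sub>1)\<close> as such would leave no hypothesis at all when
  \<open>a\<^sub>i = b\<^sub>i\<close> for all \<open>i < n\<close>, and would force \<open>\<alpha>\<^sub>n \<subseteq> \<delta>\<close>.\<close>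

definition centralizes ::
  "('f \<Rightarrow> nat) \<Rightarrow> ('f, 'a) ualg \<Rightarrow> 'a rel list \<Rightarrow> 'a rel \<Rightarrow> bool" where
  "centralizes ar A \<alpha>s \<delta> \<longleftrightarrow> (let n = length \<alpha>s in
     \<forall>k. \<forall>p\<in>polynomials ar A n k. \<forall>a b.
       (\<forall>i<n. \<forall>j<k i. (a i j, b i j) \<in> \<alpha>s ! i) \<longrightarrow>
       (\<forall>S. S \<subset> {..<n - 1} \<longrightarrow>
          (eval_poly A p (corner a b S), eval_poly A p (corner a b (insert (n - 1) S))) \<in> \<delta>) \<longrightarrow>
       (eval_poly A p (corner a b {..<n - 1}),
        eval_poly A p (corner a b (insert (n - 1) {..<n - 1}))) \<in> \<delta>)"

text \<open>The condition is preserved by arbitrary intersections of congruences, so the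
  intersection below is the least such \<open>\<delta>\<close>.\<close>

definition higher_commutator ::
  "('f \<Rightarrow> nat) \<Rightarrow> ('f, 'a) ualg \<Rightarrow> 'a rel list \<Rightarrow> 'a rel" where
  "higher_commutator ar A \<alpha>s = \<Inter>{\<delta> \<in> congruences ar A. centralizes ar A \<alpha>s \<delta>}"


section \<open>Difference terms\<close>

text \<open>The variables \<open>x, y, z\<close> are the variables \<open>0, 1, 2\<close>.\<close>

definition eval3 :: "('f, 'a) ualg \<Rightarrow> ('f, nat) trm \<Rightarrow> 'a \<Rightarrow> 'a \<Rightarrow> 'a \<Rightarrow> 'a" where
  "eval3 A c x y z = eval_trm A ((!) [x, y, z]) c"

definition n_difference_term ::
  "('f \<Rightarrow> nat) \<Rightarrow> ('f, 'a) ualg set \<Rightarrow> nat \<Rightarrow> ('f, nat) trm \<Rightarrow> bool" where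
  "n_difference_term ar V n c \<longleftrightarrow> wf_trm ar c \<and> vars c \<subseteq> {0, 1, 2} \<and>
     (\<forall>A\<in>V. \<forall>a\<in>carrier A. \<forall>b\<in>carrier A.
        (eval3 A c a b b, a) \<in> higher_commutator ar A (replicate n (cong_gen ar A {(a, b)})) \<and>
        eval3 A c b b a = a)"

end

theory Submission
  imports Defs
begin

text \<open>Let \<open>\<theta> = \<theta>(a, b)\<close> in an algebra \<open>A\<close>. A polynomial in \<open>n + 1\<close> blocks, evaluated at
  the corners given by \<open>\<theta>\<close>-related tuples, is a cube \<open>c\<close> indexed by the subsets of
  \<open>{0, \<dots>, n}\<close>. If the edges of \<open>c\<close> in the last direction \<open>n\<close> are all trivial except the one over
  \<open>{0, \<dots>, n - 1}\<close>, then the two ends of that last edge are related by every \<open>\<delta>\<close> with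
  \<open>C(\<theta>, \<dots>, \<theta>; \<delta>)\<close>, and hence by the commutator with \<open>n + 1\<close> entries. So it is enough to
  find a term \<open>c\<close> with \<open>c(y, y, x) = x\<close> for which \<open>x\<close> and \<open>c(x, y, y)\<close> are joined by a chain of such
  last edges. It is built by induction on \<open>n\<close>, starting from \<open>c(x, y, z) = z\<close> for \<open>n = 0\<close>, where
  \<open>(x, y)\<close> is itself an edge.

  To raise the dimension, modularity of the free algebra is used in the form of a chain
  \<open>m\<^sub>0 = x, \<dots>, m\<^sub>k = w\<close> of Day terms, all with \<open>m(x, y, y, x) = x\<close>, in which neighbours agree
  either on all \<open>(x, y, y, w)\<close> or on all \<open>(x, x, w, w)\<close> (\<open>day_terms\<close>). Let \<open>m\<close> be one of them,
  \<open>(x, y)\<close> a last edge, and \<open>U(z) = m(y, y, z, x)\<close>. For \<open>{z\<^sub>0, z\<^sub>1} = {x, y}\<close> the terms \<open>U(z)\<close> and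
  \<open>m(U(z\<^sub>0), z\<^sub>0, z, U(z\<^sub>0))\<close> agree at \<open>z = z\<^sub>0\<close>, because \<open>m(u, s, s, u) = u\<close>. Letting \<open>z\<close> run from
  \<open>z\<^sub>0\<close> to \<open>z\<^sub>1\<close> in the old last direction, and passing from the first term to the second in a new
  direction, one obtains a cube with one more dimension whose last edge is their value at
  \<open>z = z\<^sub>1\<close> (\<open>edges_Suc\<close>). Composing these edges along the Day terms yields one term \<open>p\<close> with
  \<open>p(y, y, x) = x\<close> such that \<open>x\<close> is chained to \<open>p(x, y, y)\<close> in dimension \<open>n + 1\<close> whenever
  \<open>(x, y)\<close> is a last edge in dimension \<open>n\<close> (\<open>difference_step_term\<close>).

  Finally, if \<open>x = v\<^sub>0, v\<^sub>1, \<dots>, v\<^sub>r = c(x, y, y)\<close> is the chain for \<open>c\<close>, the next difference term is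
  \<open>p(v\<^sub>0, v\<^sub>1, p(v\<^sub>1, v\<^sub>2, \<dots> p(v\<^sub>r\<^sub>-\<^sub>1, v\<^sub>r, c(x, y, z)) \<dots>))\<close>: for \<open>z = y\<close> it is chained to \<open>x\<close> from
  the inside out, and for \<open>x = y\<close> all \<open>v\<^sub>i\<close> equal \<open>x\<close> and it reduces to \<open>z\<close>
  (\<open>difference_terms\<close>).

  A difference term remains one at every other type because \<open>a\<close> and \<open>b\<close> generate a
  subalgebra that is a quotient of the term algebra, hence has a copy on \<open>'u\<close>, and because the
  term condition is inherited by preimages under homomorphisms (\<open>centralizes_pullback\<close>).\<close>

section \<open>Terms and congruences\<close>

fun subst :: "('v \<Rightarrow> ('f, 'w) trm) \<Rightarrow> ('f, 'v) trm \<Rightarrow> ('f, 'w) trm" where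
  "subst \<tau> (Var v) = \<tau> v"
| "subst \<tau> (Fun f ts) = Fun f (map (subst \<tau>) ts)"

lemma eval_subst: "eval_trm A \<sigma> (subst \<tau> t) = eval_trm A (\<lambda>v. eval_trm A \<sigma> (\<tau> v)) t"
  by (induction t) (auto intro!: arg_cong[of _ _ "oper A _"])

lemma subst_subst: "subst \<tau> (subst \<rho> t) = subst (\<lambda>v. subst \<tau> (\<rho> v)) t"
  by (induction t) auto

lemma wf_subst: "wf_trm ar t \<Longrightarrow> (\<And>v. v \<in> vars t \<Longrightarrow> wf_trm ar (\<tau> v)) \<Longrightarrow> wf_trm ar (subst \<tau> t)"
  by (induction t) auto

lemma vars_subst: "vars (subst \<tau> t) = (\<Union>v\<in>vars t. vars (\<tau> v))"
  by (induction t) auto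

lemma finite_vars: "finite (vars t)"
  by (induction t) auto

lemma eval_cong: "(\<And>v. v \<in> vars t \<Longrightarrow> \<sigma> v = \<sigma>' v) \<Longrightarrow> eval_trm A \<sigma> t = eval_trm A \<sigma>' t"
proof (induction t)
  case (Fun f ts)
  then have "map (eval_trm A \<sigma>) ts = map (eval_trm A \<sigma>') ts" by auto
  then show ?case by (simp only: eval_trm.simps)
qed auto

lemma eval_in_carrier:
  assumes "is_algebra ar A" "wf_trm ar t" "\<And>v. v \<in> vars t \<Longrightarrow> \<sigma> v \<in> carrier A"
  shows "eval_trm A \<sigma> t \<in> carrier A"
  using assms(2,3)
proof (induction t)
  case (Fun f ts)
  have "set (map (eval_trm A \<sigma>) ts) \<subseteq> carrier A" using Fun by auto
  then show ?case using assms(1) Fun.prems(1) unfolding is_algebra_def by simp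
qed auto

lemma congruence_carrier: "\<theta> \<in> congruences ar A \<Longrightarrow> (x, y) \<in> \<theta> \<Longrightarrow> x \<in> carrier A \<and> y \<in> carrier A"
  unfolding congruences_def equiv_def by auto

lemma congruence_refl: "\<theta> \<in> congruences ar A \<Longrightarrow> x \<in> carrier A \<Longrightarrow> (x, x) \<in> \<theta>"
  unfolding congruences_def equiv_def refl_on_def by auto

lemma congruence_sym: "\<theta> \<in> congruences ar A \<Longrightarrow> (x, y) \<in> \<theta> \<Longrightarrow> (y, x) \<in> \<theta>"
  unfolding congruences_def equiv_def by (auto dest: symD)

lemma congruence_trans:
  "\<theta> \<in> congruences ar A \<Longrightarrow> (x, y) \<in> \<theta> \<Longrightarrow> (y, z) \<in> \<theta> \<Longrightarrow> (x, z) \<in> \<theta>"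
  unfolding congruences_def equiv_def by (auto dest: transD)

lemma congruence_oper:
  "\<theta> \<in> congruences ar A \<Longrightarrow> length xs = ar f \<Longrightarrow> list_all2 (\<lambda>x y. (x, y) \<in> \<theta>) xs ys \<Longrightarrow>
    (oper A f xs, oper A f ys) \<in> \<theta>"
  unfolding congruences_def by blast

lemma congruence_eval:
  assumes "\<theta> \<in> congruences ar A" "wf_trm ar t" "\<And>v. v \<in> vars t \<Longrightarrow> (\<sigma> v, \<sigma>' v) \<in> \<theta>"
  shows "(eval_trm A \<sigma> t, eval_trm A \<sigma>' t) \<in> \<theta>"
  using assms(2,3)
proof (induction t)
  case (Fun f ts)
  have "list_all2 (\<lambda>x y. (x, y) \<in> \<theta>) (map (eval_trm A \<sigma>) ts) (map (eval_trm A \<sigma>') ts)"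
    using Fun by (auto simp: list_all2_map1 list_all2_map2 list_all2_same)
  then show ?case using congruence_oper[OF assms(1)] Fun.prems(1) by simp
qed auto

lemma congruencesI:
  assumes "\<theta> \<subseteq> carrier A \<times> carrier A" "\<And>x. x \<in> carrier A \<Longrightarrow> (x, x) \<in> \<theta>"
    "\<And>x y. (x, y) \<in> \<theta> \<Longrightarrow> (y, x) \<in> \<theta>"
    "\<And>x y z. (x, y) \<in> \<theta> \<Longrightarrow> (y, z) \<in> \<theta> \<Longrightarrow> (x, z) \<in> \<theta>"
    "\<And>f xs ys. length xs = ar f \<Longrightarrow> list_all2 (\<lambda>x y. (x, y) \<in> \<theta>) xs ys \<Longrightarrow>
      (oper A f xs, oper A f ys) \<in> \<theta>"
  shows "\<theta> \<in> congruences ar A"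
proof -
  have "equiv (carrier A) \<theta>"
    using assms(1-4) by (intro equivI refl_onI symI transI) blast+
  then show ?thesis using assms(5) unfolding congruences_def by blast
qed

lemma list_all2_in_carrier:
  assumes "list_all2 (\<lambda>x y. (x, y) \<in> \<theta>) xs ys" "\<theta> \<subseteq> C \<times> C"
  shows "set xs \<subseteq> C" "set ys \<subseteq> C"
  using assms by (induction rule: list_all2_induct) auto

lemma cong_gen_in_congruences:
  assumes "is_algebra ar A" "X \<subseteq> carrier A \<times> carrier A"
  shows "cong_gen ar A X \<in> congruences ar A"
proof -
  let ?T = "{\<theta> \<in> congruences ar A. X \<subseteq> \<theta>}"
  have "carrier A \<times> carrier A \<in> congruences ar A"
  proof (rule congruencesI)
    fix f and xs ys :: "'b list"
    assume l: "length xs = ar f" "list_all2 (\<lambda>x y. (x, y) \<in> carrier A \<times> carrier A) xs ys"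
    then show "(oper A f xs, oper A f ys) \<in> carrier A \<times> carrier A"
      using assms(1) list_all2_in_carrier[OF l(2) subset_refl] list_all2_lengthD[OF l(2)]
      unfolding is_algebra_def by auto
  qed auto
  then have top: "carrier A \<times> carrier A \<in> ?T" using assms(2) by auto
  have "\<Inter>?T \<in> congruences ar A"
  proof (rule congruencesI)
    show "\<Inter>?T \<subseteq> carrier A \<times> carrier A" using top by (rule Inter_lower)
    fix f xs ys assume l: "length xs = ar f" "list_all2 (\<lambda>x y. (x, y) \<in> \<Inter>?T) xs ys"
    show "(oper A f xs, oper A f ys) \<in> \<Inter>?T"
    proof
      fix \<theta> assume t: "\<theta> \<in> ?T"
      then have "list_all2 (\<lambda>x y. (x, y) \<in> \<theta>) xs ys"
        using l(2) by (auto elim: list_all2_mono)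
      then show "(oper A f xs, oper A f ys) \<in> \<theta>" using t l(1) congruence_oper[of \<theta> ar A xs f ys] by simp
    qed
  next
    fix x assume "x \<in> carrier A"
    then show "(x, x) \<in> \<Inter>?T" by (auto intro: congruence_refl)
  next
    fix x y assume "(x, y) \<in> \<Inter>?T"
    then show "(y, x) \<in> \<Inter>?T" by (auto intro: congruence_sym)
  next
    fix x y z assume *: "(x, y) \<in> \<Inter>?T" "(y, z) \<in> \<Inter>?T"
    show "(x, z) \<in> \<Inter>?T"
    proof
      fix \<theta> assume t: "\<theta> \<in> ?T"
      then have "(x, y) \<in> \<theta>" "(y, z) \<in> \<theta>" using * by (blast dest: InterD)+
      then show "(x, z) \<in> \<theta>" using t congruence_trans[of \<theta> ar A x y z] by simp
    qed
  qed
  then show ?thesis unfolding cong_gen_def .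
qed

lemma cong_gen_incl: "X \<subseteq> cong_gen ar A X"
  unfolding cong_gen_def by blast

lemma cong_gen_least: "\<theta> \<in> congruences ar A \<Longrightarrow> X \<subseteq> \<theta> \<Longrightarrow> cong_gen ar A X \<subseteq> \<theta>"
  unfolding cong_gen_def by blast

lemma Id_on_in_congruences:
  assumes "is_algebra ar A"
  shows "Id_on (carrier A) \<in> congruences ar A"
proof (rule congruencesI)
  fix f and xs ys :: "'b list"
  assume l: "length xs = ar f" "list_all2 (\<lambda>x y. (x, y) \<in> Id_on (carrier A)) xs ys"
  have "xs = ys" using l(2) by (induction rule: list_all2_induct) auto
  moreover have "set xs \<subseteq> carrier A" using list_all2_in_carrier(1)[OF l(2)] by auto
  ultimately show "(oper A f xs, oper A f ys) \<in> Id_on (carrier A)"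
    using assms l(1) unfolding is_algebra_def by auto
qed auto

lemma congruences_Int:
  fixes A :: "('f, 'a) ualg"
  assumes "\<alpha> \<in> congruences ar A" "\<beta> \<in> congruences ar A"
  shows "\<alpha> \<inter> \<beta> \<in> congruences ar A"
proof (rule congruencesI)
  show "\<alpha> \<inter> \<beta> \<subseteq> carrier A \<times> carrier A" using congruence_carrier[OF assms(1)] by auto
  fix f and xs ys :: "'a list"
  assume l: "length xs = ar f" "list_all2 (\<lambda>x y. (x, y) \<in> \<alpha> \<inter> \<beta>) xs ys"
  have "list_all2 (\<lambda>x y. (x, y) \<in> \<alpha>) xs ys" "list_all2 (\<lambda>x y. (x, y) \<in> \<beta>) xs ys"
    using l(2) by (auto elim: list_all2_mono)
  then show "(oper A f xs, oper A f ys) \<in> \<alpha> \<inter> \<beta>"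
    using congruence_oper[OF assms(1)] congruence_oper[OF assms(2)] l(1) by simp
qed (auto intro: congruence_refl[OF assms(1)] congruence_refl[OF assms(2)]
    congruence_sym[OF assms(1)] congruence_sym[OF assms(2)]
    congruence_trans[OF assms(1)] congruence_trans[OF assms(2)])

text \<open>An operation is applied to two lists that are related entrywise by a path of
  \<open>\<alpha>\<close>- and \<open>\<beta>\<close>-steps. The entries are changed one at a time, walking along the path at each
  entry; a single step is compatible with the operation because the other entries are related to
  themselves.\<close>

lemma rtrancl_union_congruences:
  assumes A: "is_algebra ar A" and \<alpha>: "\<alpha> \<in> congruences ar A" and \<beta>: "\<beta> \<in> congruences ar A"
  shows "(\<alpha> \<union> \<beta>)\<^sup>* \<inter> carrier A \<times> carrier A \<in> congruences ar A"
proof (rule congruencesI)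
  let ?R = "(\<alpha> \<union> \<beta>)\<^sup>*" and ?C = "carrier A"
  have "sym (\<alpha> \<union> \<beta>)" using congruence_sym[OF \<alpha>] congruence_sym[OF \<beta>] by (auto intro!: symI)
  then have "sym ?R" by (rule sym_rtrancl)
  then show "(y, x) \<in> ?R \<inter> ?C \<times> ?C" if "(x, y) \<in> ?R \<inter> ?C \<times> ?C" for x y
    using that by (auto dest: symD)
  show "(x, z) \<in> ?R \<inter> ?C \<times> ?C" if "(x, y) \<in> ?R \<inter> ?C \<times> ?C" "(y, z) \<in> ?R \<inter> ?C \<times> ?C" for x y z
    using that by (auto intro: rtrancl_trans)
  fix f and xs ys :: "'b list"
  assume l: "length xs = ar f" "list_all2 (\<lambda>x y. (x, y) \<in> ?R \<inter> ?C \<times> ?C) xs ys"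
  have same: "list_all2 (\<lambda>x y. (x, y) \<in> \<theta>) zs zs"
    if "\<theta> \<in> congruences ar A" "set zs \<subseteq> ?C" for \<theta> zs
    using that(2) congruence_refl[OF that(1)] by (auto simp: list_all2_same)
  have entry: "(oper A f (us @ x # zs), oper A f (us @ y # zs)) \<in> ?R"
    if "(x, y) \<in> ?R" "set us \<subseteq> ?C" "set zs \<subseteq> ?C" "length us + length zs + 1 = ar f" for x y us zs
    using that(1)
  proof (induction rule: rtrancl_induct)
    case (step y z)
    have "(oper A f (us @ y # zs), oper A f (us @ z # zs)) \<in> \<theta>"
      if "(y, z) \<in> \<theta>" "\<theta> \<in> congruences ar A" for \<theta>
      using that same[OF that(2) \<open>set us \<subseteq> ?C\<close>] same[OF that(2) \<open>set zs \<subseteq> ?C\<close>]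
        \<open>length us + length zs + 1 = ar f\<close>
      by (intro congruence_oper) (auto intro: list_all2_appendI)
    then show ?case using step \<alpha> \<beta> by (blast intro: rtrancl_into_rtrancl)
  qed auto
  have "(oper A f (us @ xs), oper A f (us @ ys)) \<in> ?R"
    if "set us \<subseteq> ?C" "length us + length xs = ar f" for us
    using l(2) that
  proof (induction xs ys arbitrary: us rule: list_all2_induct)
    case (Cons x xs y ys)
    have "set xs \<subseteq> ?C" using list_all2_in_carrier(1)[OF Cons.hyps(2)] by auto
    then have "(oper A f (us @ x # xs), oper A f (us @ y # xs)) \<in> ?R"
      using Cons by (intro entry) auto
    moreover have "(oper A f ((us @ [y]) @ xs), oper A f ((us @ [y]) @ ys)) \<in> ?R"
      using Cons.prems Cons.hyps by (intro Cons.IH) auto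
    ultimately show ?case by (auto intro: rtrancl_trans)
  qed auto
  from this[of "[]"] have "(oper A f xs, oper A f ys) \<in> ?R" using l(1) by simp
  moreover have "oper A f xs \<in> ?C" "oper A f ys \<in> ?C"
    using A l(1) list_all2_lengthD[OF l(2)] list_all2_in_carrier[OF l(2), of ?C]
    unfolding is_algebra_def by auto
  ultimately show "(oper A f xs, oper A f ys) \<in> ?R \<inter> ?C \<times> ?C" by blast
qed auto

section \<open>Homomorphisms\<close>

definition is_hom :: "('f \<Rightarrow> nat) \<Rightarrow> ('f, 'b) ualg \<Rightarrow> ('f, 'a) ualg \<Rightarrow> ('b \<Rightarrow> 'a) \<Rightarrow> bool" where
  "is_hom ar B A \<phi> \<longleftrightarrow> \<phi> ` carrier B \<subseteq> carrier A \<and>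
    (\<forall>f xs. length xs = ar f \<and> set xs \<subseteq> carrier B \<longrightarrow> \<phi> (oper B f xs) = oper A f (map \<phi> xs))"

definition pullback :: "('f, 'b) ualg \<Rightarrow> ('b \<Rightarrow> 'a) \<Rightarrow> 'a rel \<Rightarrow> 'b rel" where
  "pullback B \<phi> \<delta> = {(x, y) \<in> carrier B \<times> carrier B. (\<phi> x, \<phi> y) \<in> \<delta>}"

lemma hom_eval:
  assumes "is_algebra ar B" "is_hom ar B A \<phi>" "wf_trm ar t" "\<And>v. v \<in> vars t \<Longrightarrow> \<sigma> v \<in> carrier B"
  shows "\<phi> (eval_trm B \<sigma> t) = eval_trm A (\<lambda>v. \<phi> (\<sigma> v)) t"
  using assms(3,4)
proof (induction t)
  case (Fun f ts)
  have "set (map (eval_trm B \<sigma>) ts) \<subseteq> carrier B"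
    using Fun.prems by (auto intro!: eval_in_carrier[OF assms(1)])
  then have "\<phi> (oper B f (map (eval_trm B \<sigma>) ts)) = oper A f (map \<phi> (map (eval_trm B \<sigma>) ts))"
    using assms(2) Fun.prems(1) unfolding is_hom_def by simp
  also have "map \<phi> (map (eval_trm B \<sigma>) ts) = map (eval_trm A (\<lambda>v. \<phi> (\<sigma> v))) ts"
    using Fun by auto
  finally show ?case by simp
qed auto

lemma pullback_in_congruences:
  assumes "is_algebra ar B" "is_hom ar B A \<phi>" "\<delta> \<in> congruences ar A"
  shows "pullback B \<phi> \<delta> \<in> congruences ar B"
proof (rule congruencesI)
  fix x assume "x \<in> carrier B"
  then show "(x, x) \<in> pullback B \<phi> \<delta>"
    using assms(2) congruence_refl[OF assms(3)] unfolding is_hom_def pullback_def by auto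
next
  fix f and xs ys :: "'b list"
  assume l: "length xs = ar f" "list_all2 (\<lambda>x y. (x, y) \<in> pullback B \<phi> \<delta>) xs ys"
  have c: "set xs \<subseteq> carrier B" "set ys \<subseteq> carrier B" "length ys = ar f"
    using list_all2_in_carrier[OF l(2), of "carrier B"] list_all2_lengthD[OF l(2)] l(1)
    unfolding pullback_def by auto
  have "list_all2 (\<lambda>x y. (x, y) \<in> \<delta>) (map \<phi> xs) (map \<phi> ys)"
    using l(2) unfolding list_all2_map1 list_all2_map2
    by (rule list_all2_mono) (auto simp: pullback_def)
  then have "(oper A f (map \<phi> xs), oper A f (map \<phi> ys)) \<in> \<delta>"
    using congruence_oper[OF assms(3)] l(1) by simp
  then show "(oper B f xs, oper B f ys) \<in> pullback B \<phi> \<delta>"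
    using c l(1) assms(1,2) unfolding is_hom_def is_algebra_def pullback_def by auto
qed (auto simp: pullback_def intro: congruence_sym[OF assms(3)] congruence_trans[OF assms(3)])

lemma cong_gen_pullback:
  assumes "is_algebra ar B" "is_algebra ar A" "is_hom ar B A \<phi>" "X \<subseteq> carrier B \<times> carrier B"
  shows "cong_gen ar B X \<subseteq> pullback B \<phi> (cong_gen ar A (map_prod \<phi> \<phi> ` X))"
proof (rule cong_gen_least)
  have "map_prod \<phi> \<phi> ` X \<subseteq> carrier A \<times> carrier A"
    using assms(3,4) unfolding is_hom_def by auto
  then show "pullback B \<phi> (cong_gen ar A (map_prod \<phi> \<phi> ` X)) \<in> congruences ar B"
    by (intro pullback_in_congruences[OF assms(1,3)] cong_gen_in_congruences[OF assms(2)])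
  show "X \<subseteq> pullback B \<phi> (cong_gen ar A (map_prod \<phi> \<phi> ` X))"
  proof
    fix z assume z: "z \<in> X"
    then have "map_prod \<phi> \<phi> z \<in> cong_gen ar A (map_prod \<phi> \<phi> ` X)"
      using cong_gen_incl by blast
    then show "z \<in> pullback B \<phi> (cong_gen ar A (map_prod \<phi> \<phi> ` X))"
      using z assms(4) unfolding pullback_def by (cases z) auto
  qed
qed

text \<open>A homomorphism carries a polynomial of \<open>B\<close> to a polynomial of \<open>A\<close> by acting on its
  parameters, so every instance of the term condition in \<open>B\<close> is the preimage of one in \<open>A\<close>.\<close>

lemma centralizes_pullback:
  assumes B: "is_algebra ar B" and hom: "is_hom ar B A \<phi>"
    and \<theta>: "\<theta>\<^sub>B \<subseteq> pullback B \<phi> \<theta>" and C: "centralizes ar A (replicate n \<theta>) \<delta>"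
  shows "centralizes ar B (replicate n \<theta>\<^sub>B) (pullback B \<phi> \<delta>)"
  unfolding centralizes_def Let_def length_replicate
proof (intro allI ballI impI)
  fix k p a b
  assume p: "p \<in> polynomials ar B n k"
    and ab: "\<forall>i<n. \<forall>j<k i. (a i j, b i j) \<in> replicate n \<theta>\<^sub>B ! i"
    and S: "\<forall>S. S \<subset> {..<n - 1} \<longrightarrow> (eval_poly B p (corner a b S),
      eval_poly B p (corner a b (insert (n - 1) S))) \<in> pullback B \<phi> \<delta>"
  define q where "q = subst (\<lambda>v. Var (map_sum id \<phi> v)) p"
  have ab': "(a i j, b i j) \<in> \<theta>\<^sub>B" if "i < n" "j < k i" for i j
    using ab that by auto
  have wf: "wf_trm ar p" and vs: "vars p \<subseteq> Inl ` {(i, j). i < n \<and> j < k i} \<union> Inr ` carrier B"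
    using p unfolding polynomials_def by auto
  have in_B': "case_sum (\<lambda>(i, j). corner a b S i j) id v \<in> carrier B" if v: "v \<in> vars p" for v S
  proof -
    from v vs consider i j where "v = Inl (i, j)" "i < n" "j < k i" | c where "v = Inr c" "c \<in> carrier B"
      by blast
    then show ?thesis
    proof cases
      case 1
      then have "(a i j, b i j) \<in> pullback B \<phi> \<theta>" using ab' \<theta> by blast
      then show ?thesis using 1 by (simp add: pullback_def corner_def)
    qed simp
  qed
  have q: "q \<in> polynomials ar A n k"
  proof -
    have "wf_trm ar q" unfolding q_def using wf by (rule wf_subst) simp
    moreover have "map_sum id \<phi> v \<in> Inl ` {(i, j). i < n \<and> j < k i} \<union> Inr ` carrier A"
      if "v \<in> vars p" for v
    proof -
      from that vs have "v \<in> Inl ` {(i, j). i < n \<and> j < k i} \<union> Inr ` carrier B" by blast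
      moreover have "\<phi> c \<in> carrier A" if "c \<in> carrier B" for c
        using that hom unfolding is_hom_def by blast
      ultimately show ?thesis by auto
    qed
    ultimately show ?thesis unfolding polynomials_def q_def by (auto simp: vars_subst)
  qed
  have in_B: "eval_poly B p (corner a b S) \<in> carrier B" for S
    unfolding eval_poly_def using in_B' by (rule eval_in_carrier[OF B wf])
  have ev: "\<phi> (eval_poly B p (corner a b S)) =
      eval_poly A q (corner (\<lambda>i j. \<phi> (a i j)) (\<lambda>i j. \<phi> (b i j)) S)" for S
  proof -
    have "\<phi> (eval_poly B p (corner a b S)) =
        eval_trm A (\<lambda>v. \<phi> (case_sum (\<lambda>(i, j). corner a b S i j) id v)) p"
      unfolding eval_poly_def using in_B' by (rule hom_eval[OF B hom wf])
    also have "\<dots> = eval_poly A q (corner (\<lambda>i j. \<phi> (a i j)) (\<lambda>i j. \<phi> (b i j)) S)"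
      unfolding eval_poly_def q_def eval_subst
      by (rule eval_cong) (auto simp: corner_def split: sum.split)
    finally show ?thesis .
  qed
  have iff: "(eval_poly B p (corner a b S), eval_poly B p (corner a b S')) \<in> pullback B \<phi> \<delta> \<longleftrightarrow>
      (eval_poly A q (corner (\<lambda>i j. \<phi> (a i j)) (\<lambda>i j. \<phi> (b i j)) S),
       eval_poly A q (corner (\<lambda>i j. \<phi> (a i j)) (\<lambda>i j. \<phi> (b i j)) S')) \<in> \<delta>" for S S'
    unfolding pullback_def using in_B ev by auto
  have "\<forall>i<n. \<forall>j<k i. (\<phi> (a i j), \<phi> (b i j)) \<in> replicate n \<theta> ! i"
    using ab' \<theta> unfolding pullback_def by auto
  then show "(eval_poly B p (corner a b {..<n - 1}),
      eval_poly B p (corner a b (insert (n - 1) {..<n - 1}))) \<in> pullback B \<phi> \<delta>"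
    unfolding iff
    by (intro C[unfolded centralizes_def Let_def length_replicate, rule_format, OF q])
      (use S[unfolded iff] in auto)
qed

section \<open>Quotients of the term algebra on a small carrier\<close>

text \<open>Since terms are finite and \<open>'u\<close> is infinite and at least as large as the signature, the
  algebra of terms can be encoded in \<open>'u\<close>: a pairing function on \<open>'u\<close> encodes lists, and lists
  encode trees.\<close>

lemma terms_embed:
  fixes g :: "'f \<Rightarrow> 'u"
  assumes inf: "infinite (UNIV :: 'u set)" and g: "inj g"
  shows "\<exists>enc :: ('f, nat) trm \<Rightarrow> 'u. inj enc"
proof -
  have "\<exists>f :: 'u \<times> 'u \<Rightarrow> 'u. inj_on f (UNIV \<times> UNIV) \<and> f ` (UNIV \<times> UNIV) \<subseteq> UNIV"
    unfolding card_of_ordLeq using card_of_Times_same_infinite[OF inf] by (rule ordIso_imp_ordLeq)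
  then obtain pr' :: "'u \<times> 'u \<Rightarrow> 'u" where pr': "inj pr'" by auto
  obtain h :: "nat \<Rightarrow> 'u" where h: "inj h"
    using infinite_countable_subset[OF inf] by blast
  define pr where "pr x y = pr' (x, y)" for x y
  have pr: "pr x y = pr x' y' \<longleftrightarrow> x = x' \<and> y = y'" for x y x' y'
    using pr' unfolding pr_def by (auto dest: injD)
  have h01: "h 0 \<noteq> h (Suc 0)" "h (Suc 0) \<noteq> h 0" using h by (auto dest: injD)
  define lenc where "lenc = (\<lambda>xs. foldr (\<lambda>x r. pr (h 1) (pr x r)) xs (pr (h 0) (h 0)))"
  have lenc: "lenc xs = lenc ys \<Longrightarrow> xs = ys" for xs ys
  proof (induction xs arbitrary: ys)
    case Nil then show ?case by (cases ys) (auto simp: lenc_def pr h01)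
  next
    case (Cons x xs) then show ?case by (cases ys) (auto simp: lenc_def pr h01)
  qed
  define enc :: "('f, nat) trm \<Rightarrow> 'u" where
    "enc = rec_trm (\<lambda>n. pr (h 0) (h n)) (\<lambda>f ps. pr (h 1) (pr (g f) (lenc (map snd ps))))"
  have enc: "enc (Var n) = pr (h 0) (h n)"
    "enc (Fun f ts) = pr (h 1) (pr (g f) (lenc (map enc ts)))" for n f ts
    unfolding enc_def by (auto simp: comp_def)
  have "enc s = enc t \<Longrightarrow> s = t" for s t :: "('f, nat) trm"
  proof (induction s arbitrary: t)
    case (Var n) then show ?case using h by (cases t) (auto simp: enc pr h01 dest: injD)
  next
    case (Fun f ss)
    then obtain ts where t: "t = Fun f ts" and "map enc ss = map enc ts"
      using g by (cases t) (auto simp: enc pr h01 dest: injD lenc)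
    then have "length ss = length ts" "\<And>i. i < length ss \<Longrightarrow> enc (ss ! i) = enc (ts ! i)"
      by (metis length_map, metis length_map nth_map)
    then show ?case using Fun.IH t by (auto intro!: nth_equalityI)
  qed
  then have "inj enc" by (rule injI)
  then show ?thesis by blast
qed

text \<open>Any map out of the terms has, up to a bijection onto its image, a version with values
  in \<open>'u\<close>.\<close>

lemma map_on_terms_embed:
  fixes h :: "('f, nat) trm \<Rightarrow> 'z"
  assumes "infinite (UNIV :: 'u set)" "\<exists>g :: 'f \<Rightarrow> 'u. inj g"
  shows "\<exists>\<eta> :: ('f, nat) trm \<Rightarrow> 'u. \<forall>s t. \<eta> s = \<eta> t \<longleftrightarrow> h s = h t"
proof -
  obtain enc :: "('f, nat) trm \<Rightarrow> 'u" where "inj enc" using assms terms_embed by blast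
  then have "enc (inv h (h s)) = enc (inv h (h t)) \<longleftrightarrow> h s = h t" for s t
    by (metis f_inv_into_f injD rangeI)
  then show ?thesis by (intro exI[of _ "\<lambda>t. enc (inv h (h t))"]) blast
qed

abbreviation wf_terms :: "('f \<Rightarrow> nat) \<Rightarrow> ('f, nat) trm set" where
  "wf_terms ar \<equiv> {t. wf_trm ar t}"

text \<open>The quotient of the term algebra by the kernel of \<open>\<eta>\<close>, with the image of \<open>\<eta>\<close> as its
  carrier.\<close>

definition term_quotient :: "('f \<Rightarrow> nat) \<Rightarrow> (('f, nat) trm \<Rightarrow> 'u) \<Rightarrow> ('f, 'u) ualg" where
  "term_quotient ar \<eta> = \<lparr>carrier = \<eta> ` wf_terms ar,
     oper = (\<lambda>f xs. \<eta> (Fun f (map (inv_into (wf_terms ar) \<eta>) xs)))\<rparr>"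

definition compatible :: "('f \<Rightarrow> nat) \<Rightarrow> (('f, nat) trm \<Rightarrow> 'u) \<Rightarrow> bool" where
  "compatible ar \<eta> \<longleftrightarrow> (\<forall>f ss ts. map \<eta> ss = map \<eta> ts \<longrightarrow> \<eta> (Fun f ss) = \<eta> (Fun f ts))"

lemma carrier_term_quotient [simp]: "carrier (term_quotient ar \<eta>) = \<eta> ` wf_terms ar"
  unfolding term_quotient_def by simp

lemma oper_term_quotient:
  assumes "compatible ar \<eta>" "\<And>t. t \<in> set ts \<Longrightarrow> wf_trm ar t"
  shows "oper (term_quotient ar \<eta>) f (map \<eta> ts) = \<eta> (Fun f ts)"
proof -
  have "map \<eta> (map (inv_into (wf_terms ar) \<eta>) (map \<eta> ts)) = map \<eta> ts"
    using assms(2) by (auto intro!: f_inv_into_f)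
  then have "\<eta> (Fun f (map (inv_into (wf_terms ar) \<eta>) (map \<eta> ts))) = \<eta> (Fun f ts)"
    using assms(1) unfolding compatible_def by blast
  then show ?thesis unfolding term_quotient_def by (simp del: map_map)
qed

lemma lift_to_terms:
  assumes "set xs \<subseteq> \<eta> ` wf_terms ar"
  obtains ts where "xs = map \<eta> ts" "\<And>t. t \<in> set ts \<Longrightarrow> wf_trm ar t"
proof
  show "xs = map \<eta> (map (inv_into (wf_terms ar) \<eta>) xs)"
    unfolding map_map comp_def using assms by (intro map_idI[symmetric]) (auto intro: f_inv_into_f)
  show "wf_trm ar t" if "t \<in> set (map (inv_into (wf_terms ar) \<eta>) xs)" for t
    using that assms inv_into_into[of _ \<eta> "wf_terms ar"] by auto
qed

lemma is_algebra_term_quotient: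
  assumes "compatible ar \<eta>"
  shows "is_algebra ar (term_quotient ar \<eta>)"
proof -
  have "oper (term_quotient ar \<eta>) f xs \<in> \<eta> ` wf_terms ar"
    if l: "length xs = ar f" "set xs \<subseteq> \<eta> ` wf_terms ar" for f xs
  proof -
    obtain ts where "xs = map \<eta> ts" "\<And>t. t \<in> set ts \<Longrightarrow> wf_trm ar t"
      using lift_to_terms[OF l(2)] by blast
    then show ?thesis using oper_term_quotient[OF assms, of ts] l(1) by auto
  qed
  moreover have "\<eta> (Var 0) \<in> \<eta> ` wf_terms ar" by simp
  then have "\<eta> ` wf_terms ar \<noteq> {}" by blast
  ultimately show ?thesis unfolding is_algebra_def by simp
qed

lemma eval_term_quotient:
  assumes "compatible ar \<eta>" "wf_trm ar t" "\<And>v. wf_trm ar (\<tau> v)"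
  shows "eval_trm (term_quotient ar \<eta>) (\<lambda>v. \<eta> (\<tau> v)) t = \<eta> (subst \<tau> t)"
  using assms(2)
proof (induction t)
  case (Fun f ts)
  have "map (eval_trm (term_quotient ar \<eta>) (\<lambda>v. \<eta> (\<tau> v))) ts = map \<eta> (map (subst \<tau>) ts)"
    using Fun by auto
  moreover have "wf_trm ar t" if "t \<in> set (map (subst \<tau>) ts)" for t
    using that Fun.prems assms(3) by (auto intro!: wf_subst)
  ultimately show ?case
    using oper_term_quotient[OF assms(1), of "map (subst \<tau>) ts" f] by (simp only: eval_trm.simps subst.simps)
qed auto

lemma term_quotient_in_variety:
  assumes "compatible ar \<eta>" "\<And>s t. (s, t) \<in> E \<Longrightarrow> wf_trm ar s \<and> wf_trm ar t"
    "\<And>s t \<tau>. (s, t) \<in> E \<Longrightarrow> (\<And>v. wf_trm ar (\<tau> v)) \<Longrightarrow> \<eta> (subst \<tau> s) = \<eta> (subst \<tau> t)"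
  shows "term_quotient ar \<eta> \<in> variety ar E"
proof -
  have "eval_trm (term_quotient ar \<eta>) \<sigma> s = eval_trm (term_quotient ar \<eta>) \<sigma> t"
    if "(s, t) \<in> E" "range \<sigma> \<subseteq> \<eta> ` wf_terms ar" for s t and \<sigma> :: "nat \<Rightarrow> 'b"
  proof -
    have "\<forall>v. \<exists>r. wf_trm ar r \<and> \<sigma> v = \<eta> r" using that(2) by blast
    then obtain \<tau> where "\<And>v. wf_trm ar (\<tau> v)" "\<sigma> = (\<lambda>v. \<eta> (\<tau> v))" by metis
    then show ?thesis
      using eval_term_quotient[OF assms(1), of s \<tau>] eval_term_quotient[OF assms(1), of t \<tau>]
        assms(2,3) that(1) by metis
  qed
  then show ?thesis
    using is_algebra_term_quotient[OF assms(1)] unfolding variety_def by auto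
qed

lemma term_quotient_hom:
  assumes "compatible ar \<eta>" "is_algebra ar A" "range \<sigma> \<subseteq> carrier A"
    "\<And>s t. wf_trm ar s \<Longrightarrow> wf_trm ar t \<Longrightarrow> \<eta> s = \<eta> t \<Longrightarrow> eval_trm A \<sigma> s = eval_trm A \<sigma> t"
  obtains \<phi> where "is_hom ar (term_quotient ar \<eta>) A \<phi>"
    "\<And>t. wf_trm ar t \<Longrightarrow> \<phi> (\<eta> t) = eval_trm A \<sigma> t"
proof -
  define \<phi> where "\<phi> x = eval_trm A \<sigma> (inv_into (wf_terms ar) \<eta> x)" for x
  have \<phi>: "\<phi> (\<eta> t) = eval_trm A \<sigma> t" if "wf_trm ar t" for t
    unfolding \<phi>_def
  proof (rule assms(4))
    have "\<eta> t \<in> \<eta> ` wf_terms ar" using that by simp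
    then show "\<eta> (inv_into (wf_terms ar) \<eta> (\<eta> t)) = \<eta> t" "wf_trm ar (inv_into (wf_terms ar) \<eta> (\<eta> t))"
      using f_inv_into_f[of "\<eta> t" \<eta> "wf_terms ar"] inv_into_into[of "\<eta> t" \<eta> "wf_terms ar"] by auto
  qed (rule that)
  have "\<phi> (oper (term_quotient ar \<eta>) f xs) = oper A f (map \<phi> xs)"
    if l: "length xs = ar f" "set xs \<subseteq> \<eta> ` wf_terms ar" for f xs
  proof -
    obtain ts where ts: "xs = map \<eta> ts" "\<And>t. t \<in> set ts \<Longrightarrow> wf_trm ar t"
      using lift_to_terms[OF l(2)] by blast
    then have "oper (term_quotient ar \<eta>) f xs = \<eta> (Fun f ts)"
      using oper_term_quotient[OF assms(1)] by simp
    also have "\<phi> \<dots> = eval_trm A \<sigma> (Fun f ts)" using ts l(1) by (intro \<phi>) auto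
    also have "\<dots> = oper A f (map \<phi> xs)"
      using ts \<phi> by (auto intro!: arg_cong[of _ _ "oper A f"])
    finally show ?thesis .
  qed
  moreover have "\<phi> ` \<eta> ` wf_terms ar \<subseteq> carrier A"
    using \<phi> assms(3) by (auto intro!: eval_in_carrier[OF assms(2)] dest: range_subsetD)
  ultimately have "is_hom ar (term_quotient ar \<eta>) A \<phi>" unfolding is_hom_def by simp
  then show ?thesis using that \<phi> by blast
qed

section \<open>Cubes and their last edges\<close>

text \<open>The cube of a polynomial at \<open>\<theta>\<close>-related tuples, as a function of the set of directions in
  which the second tuple is taken. A variable is labelled by its direction \<open>i\<close> and by the pair
  \<open>(u, v)\<close> of values that it takes, so that terms in these variables can be combined without
  renumbering blocks. A parameter \<open>x\<close> is a variable with the pair \<open>(x, x)\<close>.\<close>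

definition cubes ::
  "('f \<Rightarrow> nat) \<Rightarrow> ('f, 'a) ualg \<Rightarrow> 'a rel \<Rightarrow> nat \<Rightarrow> (nat set \<Rightarrow> 'a) set" where
  "cubes ar A \<theta> n = {c. \<exists>t. wf_trm ar t \<and> vars t \<subseteq> {(i, u, v). i < n \<and> (u, v) \<in> \<theta>} \<and>
     c = (\<lambda>S. eval_trm A (\<lambda>(i, u, v). if i \<in> S then v else u) t)}"

lemma cubes_coordinate:
  assumes "i < n" "(u, v) \<in> \<theta>"
  shows "(\<lambda>S. if i \<in> S then v else u) \<in> cubes ar A \<theta> n"
  unfolding cubes_def using assms by (intro CollectI exI[of _ "Var (i, u, v)"]) auto

lemma cubes_const:
  assumes "\<theta> \<in> congruences ar A" "x \<in> carrier A" "0 < n"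
  shows "(\<lambda>S. x) \<in> cubes ar A \<theta> n"
  using cubes_coordinate[OF assms(3) congruence_refl[OF assms(1,2)]] by simp

lemma cubes_eval:
  assumes "wf_trm ar t" "\<And>j. j \<in> vars t \<Longrightarrow> cs j \<in> cubes ar A \<theta> n"
  shows "(\<lambda>S. eval_trm A (\<lambda>j. cs j S) t) \<in> cubes ar A \<theta> n"
proof -
  have "\<forall>j. \<exists>r. j \<in> vars t \<longrightarrow> wf_trm ar r \<and> vars r \<subseteq> {(i, u, v). i < n \<and> (u, v) \<in> \<theta>} \<and>
      cs j = (\<lambda>S. eval_trm A (\<lambda>(i, u, v). if i \<in> S then v else u) r)"
    using assms(2) unfolding cubes_def by blast
  then obtain r where r: "\<And>j. j \<in> vars t \<Longrightarrow> wf_trm ar (r j) \<and>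
      vars (r j) \<subseteq> {(i, u, v). i < n \<and> (u, v) \<in> \<theta>} \<and>
      cs j = (\<lambda>S. eval_trm A (\<lambda>(i, u, v). if i \<in> S then v else u) (r j))" by metis
  have "(\<lambda>S. eval_trm A (\<lambda>j. cs j S) t) =
      (\<lambda>S. eval_trm A (\<lambda>(i, u, v). if i \<in> S then v else u) (subst r t))"
    unfolding eval_subst using r by (intro ext eval_cong) auto
  moreover have "wf_trm ar (subst r t)" using assms(1) r by (auto intro: wf_subst)
  moreover have "vars (subst r t) \<subseteq> {(i, u, v). i < n \<and> (u, v) \<in> \<theta>}"
    unfolding vars_subst using r by (intro UN_least) blast
  ultimately show ?thesis unfolding cubes_def by blast
qed

text \<open>New cubes are cut out of old ones by fixing a direction at either end, or by replacing it
  with another direction, possibly reversed. Reversal is where symmetry of \<open>\<theta>\<close> enters.\<close>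

lemma cubes_reindex:
  assumes \<theta>: "\<theta> \<in> congruences ar A" and c: "c \<in> cubes ar A \<theta> n" and "0 < k"
    and \<psi>: "\<And>i. i < n \<Longrightarrow> (\<forall>S. i \<in> \<psi> S) \<or> (\<forall>S. i \<notin> \<psi> S) \<or>
      (\<exists>j<k. \<forall>S. i \<in> \<psi> S \<longleftrightarrow> j \<in> S) \<or> (\<exists>j<k. \<forall>S. i \<in> \<psi> S \<longleftrightarrow> j \<notin> S)"
  shows "(\<lambda>S. c (\<psi> S)) \<in> cubes ar A \<theta> k"
proof -
  obtain t where t: "wf_trm ar t" "vars t \<subseteq> {(i, u, v). i < n \<and> (u, v) \<in> \<theta>}"
    "c = (\<lambda>S. eval_trm A (\<lambda>(i, u, v). if i \<in> S then v else u) t)"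
    using c unfolding cubes_def by blast
  have "(\<lambda>S. (\<lambda>(i, u, v). if i \<in> \<psi> S then v else u) l) \<in> cubes ar A \<theta> k" if "l \<in> vars t" for l
  proof -
    obtain i u v where l: "l = (i, u, v)" "i < n" "(u, v) \<in> \<theta>" using t(2) \<open>l \<in> vars t\<close> by blast
    have uv: "u \<in> carrier A" "v \<in> carrier A" "(v, u) \<in> \<theta>"
      using congruence_carrier[OF \<theta> l(3)] congruence_sym[OF \<theta> l(3)] by auto
    consider "\<forall>S. i \<in> \<psi> S" | "\<forall>S. i \<notin> \<psi> S" | j where "j < k" "\<forall>S. i \<in> \<psi> S \<longleftrightarrow> j \<in> S" |
      j where "j < k" "\<forall>S. i \<in> \<psi> S \<longleftrightarrow> j \<notin> S"
      using \<psi>[OF l(2)] by blast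
    then show ?thesis
    proof cases
      case 1 then show ?thesis using cubes_const[OF \<theta> uv(2) \<open>0 < k\<close>] by (simp add: l)
    next
      case 2 then show ?thesis using cubes_const[OF \<theta> uv(1) \<open>0 < k\<close>] by (simp add: l)
    next
      case 3 then show ?thesis using cubes_coordinate[OF 3(1) l(3)] by (simp add: l)
    next
      case 4
      have "i \<in> \<psi> S \<longleftrightarrow> j \<notin> S" for S using 4(2) by blast
      then have "(\<lambda>S. if i \<in> \<psi> S then v else u) = (\<lambda>S. if j \<in> S then u else v)"
        by (intro ext) simp
      then show ?thesis using cubes_coordinate[OF 4(1) uv(3)] by (simp add: l)
    qed
  qed
  then show ?thesis unfolding t(3) by (rule cubes_eval[OF t(1)])
qed

lemma cubes_related:
  assumes "\<theta> \<in> congruences ar A" "c \<in> cubes ar A \<theta> n"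
  shows "(c S, c T) \<in> \<theta>"
proof -
  obtain t where t: "wf_trm ar t" "vars t \<subseteq> {(i, u, v). i < n \<and> (u, v) \<in> \<theta>}"
    "c = (\<lambda>S. eval_trm A (\<lambda>(i, u, v). if i \<in> S then v else u) t)"
    using assms(2) unfolding cubes_def by blast
  show ?thesis unfolding t(3)
  proof (rule congruence_eval[OF assms(1) t(1)])
    fix l assume "l \<in> vars t"
    then obtain i u v where l: "l = (i, u, v)" "(u, v) \<in> \<theta>" using t(2) by blast
    then show "((\<lambda>(i, u, v). if i \<in> S then v else u) l, (\<lambda>(i, u, v). if i \<in> T then v else u) l) \<in> \<theta>"
      using congruence_carrier[OF assms(1) l(2)] congruence_sym[OF assms(1) l(2)]
        congruence_refl[OF assms(1)] by auto
  qed
qed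

text \<open>The pairs that the term condition with \<open>n + 1\<close> entries puts into \<open>\<delta>\<close> when its hypotheses
  hold as equalities.\<close>

definition edges :: "('f \<Rightarrow> nat) \<Rightarrow> ('f, 'a) ualg \<Rightarrow> 'a rel \<Rightarrow> nat \<Rightarrow> 'a rel" where
  "edges ar A \<theta> n = {(c {..<n}, c (insert n {..<n})) | c. c \<in> cubes ar A \<theta> (Suc n) \<and>
     (\<forall>S. S \<subset> {..<n} \<longrightarrow> c S = c (insert n S))}"

lemma edgesI:
  assumes "c \<in> cubes ar A \<theta> (Suc n)" "\<And>S. S \<subset> {..<n} \<Longrightarrow> c S = c (insert n S)"
    "x = c {..<n}" "y = c (insert n {..<n})"
  shows "(x, y) \<in> edges ar A \<theta> n"
  unfolding edges_def using assms by blast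

lemma edgesE:
  assumes "(x, y) \<in> edges ar A \<theta> n"
  obtains c where "c \<in> cubes ar A \<theta> (Suc n)" "\<forall>S. S \<subset> {..<n} \<longrightarrow> c S = c (insert n S)"
    "x = c {..<n}" "y = c (insert n {..<n})"
  using assms unfolding edges_def by blast

lemma edges_subset: "\<theta> \<in> congruences ar A \<Longrightarrow> edges ar A \<theta> n \<subseteq> \<theta>"
  unfolding edges_def by (auto intro: cubes_related)

lemma edges_refl:
  assumes "\<theta> \<in> congruences ar A" "x \<in> carrier A"
  shows "(x, x) \<in> edges ar A \<theta> n"
  using cubes_const[OF assms zero_less_Suc] by (rule edgesI) auto

lemma edges_eval:
  assumes \<theta>: "\<theta> \<in> congruences ar A" and e: "(x, y) \<in> edges ar A \<theta> n" and t: "wf_trm ar t"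
    and \<rho>: "\<And>j. \<rho> j \<in> carrier A"
  shows "(eval_trm A (\<lambda>j. if j \<in> J then x else \<rho> j) t,
    eval_trm A (\<lambda>j. if j \<in> J then y else \<rho> j) t) \<in> edges ar A \<theta> n"
proof -
  obtain c where c: "c \<in> cubes ar A \<theta> (Suc n)" "\<forall>S. S \<subset> {..<n} \<longrightarrow> c S = c (insert n S)"
    "x = c {..<n}" "y = c (insert n {..<n})" using e by (rule edgesE)
  have "(if j \<in> J then c else (\<lambda>S. \<rho> j)) \<in> cubes ar A \<theta> (Suc n)" for j
    using c(1) cubes_const[OF \<theta> \<rho> zero_less_Suc] by simp
  then have "(\<lambda>S. eval_trm A (\<lambda>j. (if j \<in> J then c else (\<lambda>S. \<rho> j)) S) t) \<in> cubes ar A \<theta> (Suc n)"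
    by (intro cubes_eval[OF t])
  then show ?thesis
  proof (rule edgesI)
    fix S assume "S \<subset> {..<n}"
    then show "eval_trm A (\<lambda>j. (if j \<in> J then c else (\<lambda>S. \<rho> j)) S) t =
        eval_trm A (\<lambda>j. (if j \<in> J then c else (\<lambda>S. \<rho> j)) (insert n S)) t"
      using c(2) by (intro eval_cong) auto
  qed (auto simp: c(3,4) intro!: eval_cong)
qed

text \<open>The term condition has blocks of variables with given tuples of values. Listing the labels
  of a term of a cube, and giving every block a variable for each entry of the list, turns the
  term into a polynomial whose corners are the values of the cube.\<close>

lemma centralizes_edges:
  assumes C: "centralizes ar A (replicate (Suc n) \<theta>) \<delta>" and \<delta>: "\<delta> \<in> congruences ar A"
    and A: "is_algebra ar A" and \<theta>: "\<theta> \<in> congruences ar A"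
  shows "edges ar A \<theta> n \<subseteq> \<delta>"
proof
  fix e assume e: "e \<in> edges ar A \<theta> n"
  obtain x y where xy: "e = (x, y)" by (cases e)
  obtain c where c: "c \<in> cubes ar A \<theta> (Suc n)" "\<forall>S. S \<subset> {..<n} \<longrightarrow> c S = c (insert n S)"
    "x = c {..<n}" "y = c (insert n {..<n})" using e unfolding xy by (rule edgesE)
  obtain t where t: "wf_trm ar t" "vars t \<subseteq> {(i, u, v). i < Suc n \<and> (u, v) \<in> \<theta>}"
    "c = (\<lambda>S. eval_trm A (\<lambda>(i, u, v). if i \<in> S then v else u) t)"
    using c(1) unfolding cubes_def by blast
  obtain L where L: "set L = vars t" using finite_list[OF finite_vars[of t]] by blast
  have "\<forall>l. \<exists>j. l \<in> vars t \<longrightarrow> j < length L \<and> L ! j = l" using L by (metis in_set_conv_nth)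
  then obtain idx where idx: "\<And>l. l \<in> vars t \<Longrightarrow> idx l < length L \<and> L ! idx l = l" by metis
  define p :: "('a, nat \<times> nat + 'b) trm" where "p = subst (\<lambda>l. Var (Inl (fst l, idx l))) t"
  define a where "a = (\<lambda>(i::nat) j. fst (snd (L ! j)))"
  define b where "b = (\<lambda>(i::nat) j. snd (snd (L ! j)))"
  have p: "p \<in> polynomials ar A (Suc n) (\<lambda>_. length L)"
    unfolding polynomials_def p_def using t(1,2) idx by (fastforce simp: vars_subst intro!: wf_subst)
  have ev: "eval_poly A p (corner a b S) = c S" for S
    unfolding eval_poly_def p_def eval_subst t(3)
    using idx by (intro eval_cong) (auto simp: corner_def a_def b_def split: prod.split)
  have ab: "(a i j, b i j) \<in> replicate (Suc n) \<theta> ! i" if "i < Suc n" "j < length L" for i j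
  proof -
    have "L ! j \<in> vars t" using L that(2) nth_mem by blast
    then have "(a i j, b i j) \<in> \<theta>" using t(2) unfolding a_def b_def by auto
    then show ?thesis using that(1) by (simp only: nth_replicate)
  qed
  have "(c S, c (insert n S)) \<in> \<delta>" if "S \<subset> {..<n}" for S
  proof -
    have "c S \<in> carrier A" using congruence_carrier[OF \<theta> cubes_related[OF \<theta> c(1)]] by blast
    then show ?thesis using c(2) that congruence_refl[OF \<delta>] by simp
  qed
  then have "(c {..<Suc n - 1}, c (insert (Suc n - 1) {..<Suc n - 1})) \<in> \<delta>"
    unfolding ev[symmetric]
    by (intro C[unfolded centralizes_def Let_def length_replicate, rule_format, OF p])
      (use ab in auto)
  then show "e \<in> \<delta>" unfolding xy c(3,4) by simp
qed

text \<open>An assignment for terms in four variables. Sending the remaining variables to the last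
  value makes every term a quaternary operation, whatever variables occur in it, and
  \<open>quad x y z z\<close> serves as an assignment for terms in three variables.\<close>

definition quad :: "'a \<Rightarrow> 'a \<Rightarrow> 'a \<Rightarrow> 'a \<Rightarrow> nat \<Rightarrow> 'a" where
  "quad w x y z i = (if i = 0 then w else if i = 1 then x else if i = 2 then y else z)"

lemma quad_comp: "(\<lambda>i. h (quad w x y z i)) = quad (h w) (h x) (h y) (h z)"
  by (auto simp: quad_def)

lemma quad_nth [simp]:
  "quad w x y z 0 = w" "quad w x y z (Suc 0) = x" "quad w x y z 2 = y" "quad w x y z 3 = z"
  by (simp_all add: quad_def)

lemma range_quad [simp]: "range (quad w x y z) = {w, x, y, z}"
proof
  show "{w, x, y, z} \<subseteq> range (quad w x y z)"
    using quad_nth[of w x y z] by (metis empty_subsetI insert_subset rangeI)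
qed (auto simp: quad_def)

lemma quad_in: "{w, x, y, z} \<subseteq> C \<Longrightarrow> quad w x y z i \<in> C"
  by (auto simp: quad_def)

lemma cubes_quad:
  assumes "wf_trm ar m" "c\<^sub>1 \<in> cubes ar A \<theta> n" "c\<^sub>2 \<in> cubes ar A \<theta> n" "c\<^sub>3 \<in> cubes ar A \<theta> n"
    "c\<^sub>4 \<in> cubes ar A \<theta> n"
  shows "(\<lambda>S. eval_trm A (quad (c\<^sub>1 S) (c\<^sub>2 S) (c\<^sub>3 S) (c\<^sub>4 S)) m) \<in> cubes ar A \<theta> n"
proof -
  have "(\<lambda>S. eval_trm A (\<lambda>j. quad c\<^sub>1 c\<^sub>2 c\<^sub>3 c\<^sub>4 j S) m) \<in> cubes ar A \<theta> n"
    using assms by (intro cubes_eval quad_in) auto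
  moreover have "(\<lambda>j. quad c\<^sub>1 c\<^sub>2 c\<^sub>3 c\<^sub>4 j S) = quad (c\<^sub>1 S) (c\<^sub>2 S) (c\<^sub>3 S) (c\<^sub>4 S)" for S
    by (auto simp: quad_def)
  ultimately show ?thesis by simp
qed

text \<open>The cube over \<open>(x, y)\<close> gets a new direction \<open>n + 1\<close>. Away from the top corner of the first
  \<open>n\<close> directions, \<open>x\<close> and \<open>y\<close> are replaced by equal values and idempotence of \<open>m\<close> makes everything
  collapse. Over the top corner, direction \<open>n\<close> moves \<open>z\<close> from \<open>z\<^sub>0\<close> to \<open>z\<^sub>1\<close>, and direction
  \<open>n + 1\<close> moves from \<open>m(y, y, z, x)\<close> to \<open>m(u, z\<^sub>0, z, u)\<close>. The two agree at \<open>z = z\<^sub>0\<close>, where the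
  first is \<open>u\<close> by definition and the second by \<open>m(u, s, s, u) = u\<close>. To see that this is a cube,
  write the outer arguments \<open>y\<close> and \<open>x\<close> of the first as \<open>m(y, y, y, y)\<close> and \<open>m(x, x, x, x)\<close>, which
  turn into \<open>u = m(y, y, z\<^sub>0, x)\<close> when single entries are moved between \<open>x\<close> and \<open>y\<close>.\<close>

lemma edges_Suc:
  fixes m :: "('f, nat) trm" and A :: "('f, 'a) ualg" and \<beta> :: bool
  defines "M \<equiv> \<lambda>w x y z. eval_trm A (quad w x y z) m"
  assumes A: "is_algebra ar A" and \<theta>: "\<theta> \<in> congruences ar A" and m: "wf_trm ar m"
    and idem: "\<And>u s. u \<in> carrier A \<Longrightarrow> s \<in> carrier A \<Longrightarrow> M u s s u = u"
    and e: "(x, y) \<in> edges ar A \<theta> n"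
    and z: "z\<^sub>0 = (if \<beta> then y else x)" "z\<^sub>1 = (if \<beta> then x else y)"
    and u: "u = M y y z\<^sub>0 x"
  shows "(M y y z\<^sub>1 x, M u z\<^sub>0 z\<^sub>1 u) \<in> edges ar A \<theta> (Suc n)"
proof -
  obtain c where c: "c \<in> cubes ar A \<theta> (Suc n)" "\<forall>S. S \<subset> {..<n} \<longrightarrow> c S = c (insert n S)"
    "x = c {..<n}" "y = c (insert n {..<n})" using e by (rule edgesE)
  have c_in: "c S \<in> carrier A" for S
    using congruence_carrier[OF \<theta> cubes_related[OF \<theta> c(1)]] by blast
  have M_in: "M w x y z \<in> carrier A"
    if "w \<in> carrier A" "x \<in> carrier A" "y \<in> carrier A" "z \<in> carrier A" for w x y z
    unfolding M_def using that by (intro eval_in_carrier[OF A m] quad_in) auto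
  \<comment> \<open>\<open>W b\<close> extends \<open>c\<close> to the new cube with direction \<open>n\<close> controlled by the condition \<open>b\<close>: over
    the top corner it is \<open>y\<close> where \<open>b\<close> holds, and \<open>x\<close> elsewhere.\<close>
  define W where "W b S = c (S \<inter> {..<n} \<union> (if b S then {n} else {}))" for b S
  have W: "W b \<in> cubes ar A \<theta> (Suc (Suc n))"
    if b: "(\<forall>S. b S) \<or> (\<forall>S. \<not> b S) \<or> (\<exists>j<Suc (Suc n). \<forall>S. b S \<longleftrightarrow> j \<in> S) \<or>
      (\<exists>j<Suc (Suc n). \<forall>S. b S \<longleftrightarrow> j \<notin> S)" for b
    unfolding W_def
  proof (rule cubes_reindex[OF \<theta> c(1)])
    fix i assume i: "i < Suc n"
    let ?\<psi> = "\<lambda>S. S \<inter> {..<n} \<union> (if b S then {n} else {})"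
    show "(\<forall>S. i \<in> ?\<psi> S) \<or> (\<forall>S. i \<notin> ?\<psi> S) \<or> (\<exists>j<Suc (Suc n). \<forall>S. i \<in> ?\<psi> S \<longleftrightarrow> j \<in> S) \<or>
      (\<exists>j<Suc (Suc n). \<forall>S. i \<in> ?\<psi> S \<longleftrightarrow> j \<notin> S)"
    proof (cases "i = n")
      case True
      then have "i \<in> ?\<psi> S \<longleftrightarrow> b S" for S by simp
      then show ?thesis using b by simp
    next
      case False
      then have "i < Suc (Suc n)" "i \<in> ?\<psi> S \<longleftrightarrow> i \<in> S" for S using i by simp_all
      then show ?thesis by blast
    qed
  qed simp
  have W_const: "W (\<lambda>S. True) \<in> cubes ar A \<theta> (Suc (Suc n))" "W (\<lambda>S. False) \<in> cubes ar A \<theta> (Suc (Suc n))"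
    by (rule W, simp)+
  have W_in: "W (\<lambda>S. j \<in> S) \<in> cubes ar A \<theta> (Suc (Suc n))" if "j < Suc (Suc n)" for j
    by (rule W, rule disjI2, rule disjI2, rule disjI1, rule exI[of _ j]) (simp add: that)
  have W_notin: "W (\<lambda>S. j \<notin> S) \<in> cubes ar A \<theta> (Suc (Suc n))" if "j < Suc (Suc n)" for j
    by (rule W, rule disjI2, rule disjI2, rule disjI2, rule exI[of _ j]) (simp add: that)
  have W_low: "W b S = c (S \<inter> {..<n})" if "S \<inter> {..<n} \<noteq> {..<n}" for b S
  proof -
    have "S \<inter> {..<n} \<subset> {..<n}" using that by blast
    then show ?thesis unfolding W_def using c(2) by simp
  qed
  have W_top: "W b S = (if b S then y else x)" if "S \<inter> {..<n} = {..<n}" for b S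
    unfolding W_def that c(3,4) by simp
  \<comment> \<open>Over the top corner, \<open>G\<close> moves from \<open>y\<close> to \<open>z\<^sub>0\<close> and \<open>J\<close> from \<open>x\<close> to \<open>z\<^sub>0\<close> in the new direction,
    \<open>Z\<close> from \<open>z\<^sub>0\<close> to \<open>z\<^sub>1\<close> in direction \<open>n\<close>; \<open>P\<close> moves from \<open>y\<close> and \<open>Q\<close> from \<open>x\<close> to \<open>u\<close>.\<close>
  define G where "G = W (if \<beta> then (\<lambda>S. True) else (\<lambda>S. Suc n \<notin> S))"
  define J where "J = W (if \<beta> then (\<lambda>S. Suc n \<in> S) else (\<lambda>S. False))"
  define Z where "Z = W (if \<beta> then (\<lambda>S. n \<notin> S) else (\<lambda>S. n \<in> S))"
  define P where "P S = M (W (\<lambda>S. True) S) (W (\<lambda>S. True) S) (G S) (W (\<lambda>S. Suc n \<notin> S) S)" for S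
  define Q where "Q S = M (W (\<lambda>S. Suc n \<in> S) S) (W (\<lambda>S. Suc n \<in> S) S) (J S) (W (\<lambda>S. False) S)" for S
  define D where "D S = M (P S) (G S) (Z S) (Q S)" for S
  note defs = G_def J_def Z_def P_def Q_def D_def
  have GJZ: "G \<in> cubes ar A \<theta> (Suc (Suc n))" "J \<in> cubes ar A \<theta> (Suc (Suc n))"
    "Z \<in> cubes ar A \<theta> (Suc (Suc n))"
    unfolding G_def J_def Z_def by (cases \<beta>; simp add: W_const W_in W_notin)+
  have P: "P \<in> cubes ar A \<theta> (Suc (Suc n))"
    unfolding P_def M_def by (intro cubes_quad[OF m] W_const W_in W_notin GJZ) simp_all
  have Q: "Q \<in> cubes ar A \<theta> (Suc (Suc n))"
    unfolding Q_def M_def by (intro cubes_quad[OF m] W_const W_in W_notin GJZ) simp_all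
  have D: "D \<in> cubes ar A \<theta> (Suc (Suc n))"
    unfolding D_def M_def by (intro cubes_quad[OF m] P Q GJZ)
  have xy: "x \<in> carrier A" "y \<in> carrier A" unfolding c(3,4) using c_in by auto
  then have zu: "z\<^sub>0 \<in> carrier A" "z\<^sub>1 \<in> carrier A" "u \<in> carrier A" unfolding z u by (auto intro: M_in)
  have top: "D S = M y y (if n \<in> S then z\<^sub>1 else z\<^sub>0) x"
    "D (insert (Suc n) S) = M u z\<^sub>0 (if n \<in> S then z\<^sub>1 else z\<^sub>0) u"
    if "S \<inter> {..<n} = {..<n}" "Suc n \<notin> S" for S
  proof -
    have "insert (Suc n) S \<inter> {..<n} = {..<n}" using that(1) by auto
    then show "D S = M y y (if n \<in> S then z\<^sub>1 else z\<^sub>0) x"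
      "D (insert (Suc n) S) = M u z\<^sub>0 (if n \<in> S then z\<^sub>1 else z\<^sub>0) u"
      using that xy unfolding defs u z by (simp_all add: W_top idem)
  qed
  have low: "D S = c (S \<inter> {..<n})" if "S \<inter> {..<n} \<noteq> {..<n}" for S
    unfolding defs by (simp add: W_low[OF that] idem c_in)
  show ?thesis
  proof (rule edgesI[OF D])
    fix S assume S: "S \<subset> {..<Suc n}"
    show "D S = D (insert (Suc n) S)"
    proof (cases "S \<inter> {..<n} = {..<n}")
      case True
      then have "n \<notin> S" "Suc n \<notin> S" using S by (auto simp: lessThan_Suc)
      then show ?thesis using top[OF True] zu by (simp add: idem u)
    next
      case False
      moreover have "insert (Suc n) S \<inter> {..<n} = S \<inter> {..<n}" by auto
      ultimately show ?thesis using low[of S] low[of "insert (Suc n) S"] by simp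
    qed
  next
    have *: "{..<Suc n} \<inter> {..<n} = {..<n}" "Suc n \<notin> {..<Suc n}" by auto
    show "M y y z\<^sub>1 x = D {..<Suc n}" "M u z\<^sub>0 z\<^sub>1 u = D (insert (Suc n) {..<Suc n})"
      using top[OF *] by simp_all
  qed
qed

section \<open>Links between terms\<close>

text \<open>A pair of terms that is a last edge uniformly in all algebras of \<open>V\<close>, for the congruence
  generated by the values of the first two variables \<open>x\<close> and \<open>y\<close>. The terms range over all
  variables, since a chain that starts at \<open>x\<close> collapses to \<open>x\<close> under \<open>x = y\<close> whatever the values of
  the other variables are.\<close>

definition linked :: "('f \<Rightarrow> nat) \<Rightarrow> ('f, 'a) ualg set \<Rightarrow> nat \<Rightarrow> ('f, nat) trm \<Rightarrow> ('f, nat) trm \<Rightarrow> bool"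
  where "linked ar V n s t \<longleftrightarrow> wf_trm ar s \<and> wf_trm ar t \<and>
    (\<forall>A\<in>V. \<forall>\<sigma>. range \<sigma> \<subseteq> carrier A \<longrightarrow>
      (eval_trm A \<sigma> s, eval_trm A \<sigma> t) \<in> edges ar A (cong_gen ar A {(\<sigma> 0, \<sigma> 1)}) n)"

abbreviation chained :: "('f \<Rightarrow> nat) \<Rightarrow> ('f, 'a) ualg set \<Rightarrow> nat \<Rightarrow> ('f, nat) trm \<Rightarrow> ('f, nat) trm \<Rightarrow> bool"
  where "chained ar V n \<equiv> (linked ar V n)\<^sup>*\<^sup>*"

definition satisfies :: "('f, 'a) ualg set \<Rightarrow> ('f, nat) trm \<Rightarrow> ('f, nat) trm \<Rightarrow> bool" where
  "satisfies V s t \<longleftrightarrow> (\<forall>A\<in>V. \<forall>\<sigma>. range \<sigma> \<subseteq> carrier A \<longrightarrow> eval_trm A \<sigma> s = eval_trm A \<sigma> t)"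

text \<open>The identity \<open>m(x, y, y, x) = x\<close> of Day terms.\<close>

definition absorbs :: "('f, 'a) ualg set \<Rightarrow> ('f, nat) trm \<Rightarrow> bool" where
  "absorbs V m \<longleftrightarrow> (\<forall>A\<in>V. \<forall>\<sigma>. range \<sigma> \<subseteq> carrier A \<longrightarrow> \<sigma> 0 = \<sigma> 3 \<longrightarrow> \<sigma> 1 = \<sigma> 2 \<longrightarrow>
     eval_trm A \<sigma> m = \<sigma> 0)"

text \<open>The identity \<open>e(y, y, x) = x\<close> of difference terms.\<close>

definition projects :: "('f, 'a) ualg set \<Rightarrow> ('f, nat) trm \<Rightarrow> bool" where
  "projects V e \<longleftrightarrow> (\<forall>A\<in>V. \<forall>\<sigma>. range \<sigma> \<subseteq> carrier A \<longrightarrow> \<sigma> 0 = \<sigma> 1 \<longrightarrow> eval_trm A \<sigma> e = \<sigma> 2)"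

lemma range_eval:
  assumes "is_algebra ar A" "range \<sigma> \<subseteq> carrier A" "\<And>j. wf_trm ar (\<rho> j)"
  shows "range (\<lambda>j. eval_trm A \<sigma> (\<rho> j)) \<subseteq> carrier A"
  using assms by (auto intro!: eval_in_carrier[OF assms(1)] dest: range_subsetD)

lemma eval_quad:
  "eval_trm A \<sigma> (subst (quad p q r s) t) =
    eval_trm A (quad (eval_trm A \<sigma> p) (eval_trm A \<sigma> q) (eval_trm A \<sigma> r) (eval_trm A \<sigma> s)) t"
  unfolding eval_subst quad_comp ..

lemma subst_quad: "subst \<tau> (subst (quad p q r s) t) =
    subst (quad (subst \<tau> p) (subst \<tau> q) (subst \<tau> r) (subst \<tau> s)) t"
  unfolding subst_subst quad_comp ..

lemma wf_quad:
  "wf_trm ar p \<Longrightarrow> wf_trm ar q \<Longrightarrow> wf_trm ar r \<Longrightarrow> wf_trm ar s \<Longrightarrow> wf_trm ar (quad p q r s i)"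
  by (simp add: quad_def)

text \<open>The terms \<open>t(x, y, y)\<close>.\<close>

abbreviation diag :: "('f, nat) trm \<Rightarrow> ('f, nat) trm" where
  "diag \<equiv> subst (quad (Var 0) (Var 1) (Var 1) (Var 1))"

lemma diag_diag: "diag (diag t) = diag t"
  unfolding subst_quad by simp

text \<open>Neighbours in a chain of Day terms.\<close>

definition day_step :: "('f \<Rightarrow> nat) \<Rightarrow> ('f, 'a) ualg set \<Rightarrow> ('f, nat) trm \<Rightarrow> ('f, nat) trm \<Rightarrow> bool"
  where "day_step ar V m m' \<longleftrightarrow> wf_trm ar m \<and> wf_trm ar m' \<and> absorbs V m \<and> absorbs V m' \<and>
    ((\<forall>A\<in>V. \<forall>\<sigma>. range \<sigma> \<subseteq> carrier A \<longrightarrow> \<sigma> 1 = \<sigma> 2 \<longrightarrow> eval_trm A \<sigma> m = eval_trm A \<sigma> m') \<or>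
     (\<forall>A\<in>V. \<forall>\<sigma>. range \<sigma> \<subseteq> carrier A \<longrightarrow> \<sigma> 0 = \<sigma> 1 \<longrightarrow> \<sigma> 2 = \<sigma> 3 \<longrightarrow>
       eval_trm A \<sigma> m = eval_trm A \<sigma> m'))"

text \<open>The induction hypothesis along a chain of Day terms. It holds for \<open>m = x\<close> with \<open>e = z\<close>, and
  for \<open>m = w\<close> it says that \<open>s\<close> is chained to \<open>e(s, t, t)\<close>.\<close>

definition telescoped :: "('f \<Rightarrow> nat) \<Rightarrow> ('f, 'a) ualg set \<Rightarrow> ('f, nat) trm \<Rightarrow> bool" where
  "telescoped ar V m \<longleftrightarrow> (\<exists>e. wf_trm ar e \<and> projects V e \<and> (\<forall>n s t. linked ar V n s t \<longrightarrow>
     chained ar V (Suc n) (subst (quad t t t s) m) (subst (quad s t t t) e)))"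

context
  fixes ar :: "'f \<Rightarrow> nat" and V :: "('f, 'a) ualg set"
  assumes all_algebras: "\<forall>A\<in>V. is_algebra ar A"
begin

lemma algebras: "A \<in> V \<Longrightarrow> is_algebra ar A"
  using all_algebras by blast

lemma principal_congruence:
  assumes "A \<in> V" "range \<sigma> \<subseteq> carrier A"
  shows "cong_gen ar A {(\<sigma> (i::nat), \<sigma> j)} \<in> congruences ar A"
  using cong_gen_in_congruences[OF algebras[OF assms(1)], of "{(\<sigma> i, \<sigma> j)}"] assms(2) by auto

lemma satisfies_linked:
  assumes "satisfies V s t" "wf_trm ar s" "wf_trm ar t"
  shows "linked ar V n s t"
  unfolding linked_def
proof (intro conjI ballI allI impI)
  fix A and \<sigma> :: "nat \<Rightarrow> 'a" assume A: "A \<in> V" and \<sigma>: "range \<sigma> \<subseteq> carrier A"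
  have "eval_trm A \<sigma> t \<in> carrier A"
    using eval_in_carrier[OF algebras[OF A] assms(3)] \<sigma> by blast
  then show "(eval_trm A \<sigma> s, eval_trm A \<sigma> t) \<in> edges ar A (cong_gen ar A {(\<sigma> 0, \<sigma> 1)}) n"
    using edges_refl[OF principal_congruence[OF A \<sigma>]] assms(1) A \<sigma> unfolding satisfies_def by simp
qed (use assms in auto)

lemma linked_subst:
  assumes "linked ar V n s t" "wf_trm ar m" "\<And>j. wf_trm ar (\<rho> j)"
  shows "linked ar V n (subst (\<lambda>j. if j \<in> J then s else \<rho> j) m)
    (subst (\<lambda>j. if j \<in> J then t else \<rho> j) m)"
  unfolding linked_def
proof (intro conjI ballI allI impI)
  fix A and \<sigma> :: "nat \<Rightarrow> 'a" assume A: "A \<in> V" and \<sigma>: "range \<sigma> \<subseteq> carrier A"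
  have "eval_trm A \<sigma> (\<rho> j) \<in> carrier A" for j
    using range_eval[of ar A \<sigma> \<rho>] algebras[OF A] \<sigma> assms(3) by blast
  moreover have "(eval_trm A \<sigma> s, eval_trm A \<sigma> t) \<in> edges ar A (cong_gen ar A {(\<sigma> 0, \<sigma> 1)}) n"
    using assms(1) A \<sigma> unfolding linked_def by blast
  ultimately have "(eval_trm A (\<lambda>j. if j \<in> J then eval_trm A \<sigma> s else eval_trm A \<sigma> (\<rho> j)) m,
      eval_trm A (\<lambda>j. if j \<in> J then eval_trm A \<sigma> t else eval_trm A \<sigma> (\<rho> j)) m)
      \<in> edges ar A (cong_gen ar A {(\<sigma> 0, \<sigma> 1)}) n"
    by (intro edges_eval[OF principal_congruence[OF A \<sigma>] _ assms(2)])
  then show "(eval_trm A \<sigma> (subst (\<lambda>j. if j \<in> J then s else \<rho> j) m),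
      eval_trm A \<sigma> (subst (\<lambda>j. if j \<in> J then t else \<rho> j) m))
      \<in> edges ar A (cong_gen ar A {(\<sigma> 0, \<sigma> 1)}) n"
    unfolding eval_subst by (simp only: if_distrib[of "eval_trm A \<sigma>"])
qed (use assms in \<open>auto simp: linked_def intro!: wf_subst\<close>)

lemma chained_subst:
  assumes "chained ar V n s t" "wf_trm ar m" "\<And>j. wf_trm ar (\<rho> j)"
  shows "chained ar V n (subst (\<lambda>j. if j \<in> J then s else \<rho> j) m)
    (subst (\<lambda>j. if j \<in> J then t else \<rho> j) m)"
  using assms(1)
proof (induction rule: rtranclp_induct)
  case (step t t')
  then show ?case using linked_subst[OF step.hyps(2) assms(2,3)] by (rule_tac rtranclp.rtrancl_into_rtrancl)
qed auto

lemma chained_outer: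
  assumes "chained ar V n s t" "wf_trm ar m" "wf_trm ar q" "wf_trm ar r"
  shows "chained ar V n (subst (quad s q r s) m) (subst (quad t q r t) m)"
proof -
  have "(\<lambda>j. if j \<in> - {1, 2} then u else quad (Var 0) q r (Var 0) j) = quad u q r u" for u
    by (auto simp: quad_def)
  then show ?thesis
    using chained_subst[OF assms(1,2), of "quad (Var 0) q r (Var 0)" "- {1, 2}"] assms(3,4)
    by (simp add: wf_quad)
qed

lemma chained_third:
  assumes "chained ar V n s t" "wf_trm ar m" "wf_trm ar q" "wf_trm ar r"
  shows "chained ar V n (subst (quad q r s s) m) (subst (quad q r t t) m)"
proof -
  have "(\<lambda>j. if j \<in> - {0, 1} then u else quad q r (Var 0) (Var 0) j) = quad q r u u" for u
    by (auto simp: quad_def)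
  then show ?thesis
    using chained_subst[OF assms(1,2), of "quad q r (Var 0) (Var 0)" "- {0, 1}"] assms(3,4)
    by (simp add: wf_quad)
qed

lemma linked_Suc:
  fixes \<beta> :: bool
  assumes l: "linked ar V n s t" and m: "wf_trm ar m" "absorbs V m"
    and z: "z\<^sub>0 = (if \<beta> then t else s)" "z\<^sub>1 = (if \<beta> then s else t)"
    and u: "u = subst (quad t t z\<^sub>0 s) m"
  shows "linked ar V (Suc n) (subst (quad t t z\<^sub>1 s) m) (subst (quad u z\<^sub>0 z\<^sub>1 u) m)"
proof -
  have wf: "wf_trm ar s" "wf_trm ar t" using l unfolding linked_def by auto
  then have wz: "wf_trm ar z\<^sub>0" "wf_trm ar z\<^sub>1" unfolding z by auto
  have wu: "wf_trm ar u" unfolding u using m wf wz by (intro wf_subst wf_quad)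
  show ?thesis
    unfolding linked_def
  proof (intro conjI ballI allI impI)
    fix A and \<sigma> :: "nat \<Rightarrow> 'a" assume A: "A \<in> V" and \<sigma>: "range \<sigma> \<subseteq> carrier A"
    have "(eval_trm A \<sigma> s, eval_trm A \<sigma> t) \<in> edges ar A (cong_gen ar A {(\<sigma> 0, \<sigma> 1)}) n"
      using l A \<sigma> unfolding linked_def by blast
    moreover have "eval_trm A (quad v w w v) m = v" if "v \<in> carrier A" "w \<in> carrier A" for v w
    proof -
      have "range (quad v w w v) \<subseteq> carrier A" using that by simp
      then show ?thesis using m(2) A unfolding absorbs_def by fastforce
    qed
    ultimately show "(eval_trm A \<sigma> (subst (quad t t z\<^sub>1 s) m),
        eval_trm A \<sigma> (subst (quad u z\<^sub>0 z\<^sub>1 u) m))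
        \<in> edges ar A (cong_gen ar A {(\<sigma> 0, \<sigma> 1)}) (Suc n)"
      unfolding eval_quad
      by (intro edges_Suc[OF algebras[OF A] principal_congruence[OF A \<sigma>] m(1), where \<beta> = \<beta>])
        (simp_all add: z u eval_quad)
  qed (use m wf wz wu in \<open>auto intro!: wf_subst wf_quad\<close>)
qed

lemma linked_diag:
  assumes "linked ar V n s t"
  shows "linked ar V n (diag s) (diag t)"
  unfolding linked_def
proof (intro conjI ballI allI impI)
  fix A and \<sigma> :: "nat \<Rightarrow> 'a" assume A: "A \<in> V" and \<sigma>: "range \<sigma> \<subseteq> carrier A"
  let ?\<sigma> = "quad (\<sigma> 0) (\<sigma> 1) (\<sigma> 1) (\<sigma> 1)"
  have "range ?\<sigma> \<subseteq> carrier A" using \<sigma> by auto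
  then have "(eval_trm A ?\<sigma> s, eval_trm A ?\<sigma> t)
      \<in> edges ar A (cong_gen ar A {(?\<sigma> 0, ?\<sigma> 1)}) n"
    using assms A unfolding linked_def by blast
  then show "(eval_trm A \<sigma> (diag s), eval_trm A \<sigma> (diag t))
      \<in> edges ar A (cong_gen ar A {(\<sigma> 0, \<sigma> 1)}) n"
    unfolding eval_quad by simp
qed (use assms in \<open>auto simp: linked_def intro!: wf_subst wf_quad\<close>)

text \<open>When \<open>x = y\<close>, the generated congruence is equality and every link is trivial.\<close>

lemma chained_collapse:
  assumes "chained ar V n (Var 0) t" "A \<in> V" "range \<sigma> \<subseteq> carrier A" "\<sigma> 0 = \<sigma> 1"
  shows "eval_trm A \<sigma> t = \<sigma> 0"
  using assms(1)
proof (induction rule: rtranclp_induct)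
  case (step s t)
  have "cong_gen ar A {(\<sigma> 0, \<sigma> 1)} \<subseteq> Id_on (carrier A)"
    using assms(3,4) by (intro cong_gen_least Id_on_in_congruences algebras assms(2)) auto
  then have "edges ar A (cong_gen ar A {(\<sigma> 0, \<sigma> 1)}) n \<subseteq> Id_on (carrier A)"
    using edges_subset[OF principal_congruence[OF assms(2,3)]] by blast
  moreover have "(eval_trm A \<sigma> s, eval_trm A \<sigma> t)
      \<in> edges ar A (cong_gen ar A {(\<sigma> 0, \<sigma> 1)}) n"
    using step.hyps(2) assms(2,3) unfolding linked_def by blast
  ultimately show ?case using step.IH by auto
qed simp

lemma chained_commutator:
  assumes "chained ar V n (Var 0) t" and A: "A \<in> V" and \<sigma>: "range \<sigma> \<subseteq> carrier A"
  shows "(eval_trm A \<sigma> t, \<sigma> 0) \<in>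
    higher_commutator ar A (replicate (Suc n) (cong_gen ar A {(\<sigma> 0, \<sigma> 1)}))"
  unfolding higher_commutator_def
proof (intro InterI, elim CollectE conjE)
  fix \<delta> assume \<delta>: "\<delta> \<in> congruences ar A"
    and C: "centralizes ar A (replicate (Suc n) (cong_gen ar A {(\<sigma> 0, \<sigma> 1)})) \<delta>"
  have sub: "edges ar A (cong_gen ar A {(\<sigma> 0, \<sigma> 1)}) n \<subseteq> \<delta>"
    using centralizes_edges[OF C \<delta> algebras[OF A] principal_congruence[OF A \<sigma>]] .
  show "(eval_trm A \<sigma> t, \<sigma> 0) \<in> \<delta>"
    using assms(1)
  proof (induction rule: rtranclp_induct)
    case base
    then show ?case using congruence_refl[OF \<delta>] \<sigma> by auto
  next
    case (step s t)
    have "(eval_trm A \<sigma> s, eval_trm A \<sigma> t) \<in> \<delta>"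
      using step.hyps(2) A \<sigma> sub unfolding linked_def by blast
    then show ?case using step.IH congruence_sym[OF \<delta>] congruence_trans[OF \<delta>] by blast
  qed
qed

section \<open>From Day terms to difference terms\<close>

lemma projects_quad:
  assumes "projects V e" "absorbs V m" "wf_trm ar e"
    and q: "q = Var 0 \<and> r = Var 1 \<or> q = Var 1 \<and> r = Var 0"
  shows "projects V (subst (quad e q r e) m)"
  unfolding projects_def
proof (intro ballI allI impI)
  fix A and \<sigma> :: "nat \<Rightarrow> 'a" assume A: "A \<in> V" and \<sigma>: "range \<sigma> \<subseteq> carrier A" "\<sigma> 0 = \<sigma> 1"
  have e: "eval_trm A \<sigma> e = \<sigma> 2" using assms(1) A \<sigma> unfolding projects_def by blast
  have "eval_trm A \<sigma> q = \<sigma> 1" "eval_trm A \<sigma> r = \<sigma> 1" using q \<sigma>(2) by auto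
  then have "eval_trm A \<sigma> (subst (quad e q r e) m) = eval_trm A (quad (\<sigma> 2) (\<sigma> 1) (\<sigma> 1) (\<sigma> 2)) m"
    unfolding eval_quad e by simp
  also have "\<dots> = \<sigma> 2"
  proof -
    have "range (quad (\<sigma> 2) (\<sigma> 1) (\<sigma> 1) (\<sigma> 2)) \<subseteq> carrier A" using \<sigma> by auto
    then show ?thesis using assms(2) A unfolding absorbs_def by fastforce
  qed
  finally show "eval_trm A \<sigma> (subst (quad e q r e) m) = \<sigma> 2" .
qed

text \<open>The values \<open>m(t, t, t, s)\<close> are unchanged when \<open>m\<close> and \<open>m'\<close> agree on all \<open>(x, y, y, w)\<close>. When
  they agree on all \<open>(x, x, w, w)\<close>, it is \<open>m(t, t, s, s)\<close> that is unchanged, and one passes from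
  \<open>m(t, t, t, s)\<close> to \<open>m(t, t, s, s)\<close> and, for \<open>m'\<close>, back again by the two forms of
  \<open>linked_Suc\<close>. Both passages are mirrored by the terms \<open>f = m(e, y, x, e)\<close> and
  \<open>g = m'(f, x, y, f)\<close>.\<close>

lemma telescoped_step:
  assumes "telescoped ar V m" "day_step ar V m m'"
  shows "telescoped ar V m'"
proof -
  obtain e where e: "wf_trm ar e" "projects V e" "\<And>n s t. linked ar V n s t \<Longrightarrow>
      chained ar V (Suc n) (subst (quad t t t s) m) (subst (quad s t t t) e)"
    using assms(1) unfolding telescoped_def by blast
  have m: "wf_trm ar m" "absorbs V m" "wf_trm ar m'" "absorbs V m'"
    using assms(2) unfolding day_step_def by auto
  from assms(2) consider
    (inner) "\<And>A \<sigma>. A \<in> V \<Longrightarrow> range \<sigma> \<subseteq> carrier A \<Longrightarrow> \<sigma> 1 = \<sigma> 2 \<Longrightarrow>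
      eval_trm A \<sigma> m = eval_trm A \<sigma> m'" |
    (pairs) "\<And>A \<sigma>. A \<in> V \<Longrightarrow> range \<sigma> \<subseteq> carrier A \<Longrightarrow> \<sigma> 0 = \<sigma> 1 \<Longrightarrow> \<sigma> 2 = \<sigma> 3 \<Longrightarrow>
      eval_trm A \<sigma> m = eval_trm A \<sigma> m'"
    unfolding day_step_def by blast
  then show ?thesis
  proof cases
    case inner
    have "chained ar V (Suc n) (subst (quad t t t s) m') (subst (quad s t t t) e)"
      if l: "linked ar V n s t" for n s t
    proof -
      have wf: "wf_trm ar s" "wf_trm ar t" using l unfolding linked_def by auto
      have "satisfies V (subst (quad t t t s) m') (subst (quad t t t s) m)"
        unfolding satisfies_def
      proof (intro ballI allI impI)
        fix A and \<sigma> :: "nat \<Rightarrow> 'a" assume A: "A \<in> V" and \<sigma>: "range \<sigma> \<subseteq> carrier A"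
        have "eval_trm A \<sigma> s \<in> carrier A" "eval_trm A \<sigma> t \<in> carrier A"
          using eval_in_carrier[OF algebras[OF A]] wf \<sigma> by blast+
        then show "eval_trm A \<sigma> (subst (quad t t t s) m') = eval_trm A \<sigma> (subst (quad t t t s) m)"
          unfolding eval_quad using inner[OF A] by simp
      qed
      then have "linked ar V (Suc n) (subst (quad t t t s) m') (subst (quad t t t s) m)"
        using m wf by (intro satisfies_linked wf_subst wf_quad)
      then show ?thesis using e(3)[OF l] by (rule converse_rtranclp_into_rtranclp)
    qed
    then show ?thesis unfolding telescoped_def using e(1,2) by blast
  next
    case pairs
    define f where "f = subst (quad e (Var 1) (Var 0) e) m"
    define g where "g = subst (quad f (Var 0) (Var 1) f) m'"
    have f: "wf_trm ar f" "projects V f"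
      unfolding f_def using e m by (auto intro!: wf_subst wf_quad projects_quad)
    have g: "wf_trm ar g" "projects V g"
      unfolding g_def using f m by (auto intro!: wf_subst wf_quad projects_quad)
    have "chained ar V (Suc n) (subst (quad t t t s) m') (subst (quad s t t t) g)"
      if l: "linked ar V n s t" for n s t
    proof -
      have wf: "wf_trm ar s" "wf_trm ar t" using l unfolding linked_def by auto
      define e' where "e' = subst (quad s t t t) e"
      define f' where "f' = subst (quad s t t t) f"
      define u where "u = subst (quad t t t s) m"
      define u' where "u' = subst (quad t t s s) m'"
      have f': "f' = subst (quad e' t s e') m"
        unfolding f'_def f_def e'_def subst_quad by simp
      have g': "subst (quad s t t t) g = subst (quad f' s t f') m'"
        unfolding g_def f'_def subst_quad by simp
      have "satisfies V u' (subst (quad t t s s) m)"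
        unfolding satisfies_def u'_def
      proof (intro ballI allI impI)
        fix A and \<sigma> :: "nat \<Rightarrow> 'a" assume A: "A \<in> V" and \<sigma>: "range \<sigma> \<subseteq> carrier A"
        have "eval_trm A \<sigma> s \<in> carrier A" "eval_trm A \<sigma> t \<in> carrier A"
          using eval_in_carrier[OF algebras[OF A]] wf \<sigma> by blast+
        then show "eval_trm A \<sigma> (subst (quad t t s s) m') = eval_trm A \<sigma> (subst (quad t t s s) m)"
          unfolding eval_quad using pairs[OF A] by simp
      qed
      then have a: "linked ar V (Suc n) u' (subst (quad t t s s) m)"
        using m wf by (intro satisfies_linked) (auto simp: u'_def intro!: wf_subst wf_quad)
      have b: "linked ar V (Suc n) (subst (quad t t s s) m) (subst (quad u t s u) m)"
        using linked_Suc[OF l m(1,2), of t True s u] by (simp add: u_def)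
      have c: "chained ar V (Suc n) (subst (quad u t s u) m) (subst (quad e' t s e') m)"
        using e(3)[OF l] wf m unfolding u_def e'_def by (intro chained_outer)
      have "chained ar V (Suc n) u' f'"
        unfolding f' by (rule converse_rtranclp_into_rtranclp[OF a converse_rtranclp_into_rtranclp[OF b c]])
      then have "chained ar V (Suc n) (subst (quad u' s t u') m') (subst (quad f' s t f') m')"
        using wf m by (intro chained_outer)
      moreover have "linked ar V (Suc n) (subst (quad t t t s) m') (subst (quad u' s t u') m')"
        using linked_Suc[OF l m(3,4), of s False t u'] by (simp add: u'_def)
      ultimately show ?thesis unfolding g' by (rule converse_rtranclp_into_rtranclp[rotated])
    qed
    then show ?thesis unfolding telescoped_def using g by blast
  qed
qed

lemma difference_step_term:
  assumes "(day_step ar V)\<^sup>*\<^sup>* (Var 0) (Var 3)"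
  obtains p where "wf_trm ar p" "projects V p" "\<And>n s t. linked ar V n s t \<Longrightarrow>
      chained ar V (Suc n) s (subst (quad s t t t) p)"
proof -
  have "telescoped ar V (Var 0)"
    unfolding telescoped_def by (intro exI[of _ "Var 2"]) (auto simp: projects_def)
  with assms have "telescoped ar V (Var 3)"
    by (induction rule: rtranclp_induct) (auto intro: telescoped_step)
  then show ?thesis using that unfolding telescoped_def by auto
qed

text \<open>The nested term is built from the inside: \<open>w\<close> is the part that belongs to the chain from \<open>v\<close>
  onwards, and a link \<open>(v, v')\<close> in front of it turns \<open>w\<close> into \<open>p(v, v', w)\<close>.\<close>

lemma difference_terms:
  assumes "(day_step ar V)\<^sup>*\<^sup>* (Var 0) (Var 3)"
  shows "\<exists>c. wf_trm ar c \<and> projects V c \<and> chained ar V n (Var 0) (diag c)"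
proof (induction n)
  case 0
  have "linked ar V 0 (Var 0) (Var 1)"
    unfolding linked_def
  proof (intro conjI ballI allI impI)
    fix A and \<sigma> :: "nat \<Rightarrow> 'a" assume A: "A \<in> V" and \<sigma>: "range \<sigma> \<subseteq> carrier A"
    have "(\<sigma> 0, \<sigma> 1) \<in> cong_gen ar A {(\<sigma> 0, \<sigma> 1)}" using cong_gen_incl by blast
    from cubes_coordinate[OF zero_less_Suc this]
    have "(\<sigma> 0, \<sigma> 1) \<in> edges ar A (cong_gen ar A {(\<sigma> 0, \<sigma> 1)}) 0" by (rule edgesI) auto
    then show "(eval_trm A \<sigma> (Var 0), eval_trm A \<sigma> (Var 1))
        \<in> edges ar A (cong_gen ar A {(\<sigma> 0, \<sigma> 1)}) 0" by simp
  qed auto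
  then show ?case by (intro exI[of _ "Var 2"]) (auto simp: projects_def)
next
  case (Suc n)
  obtain p where p: "wf_trm ar p" "projects V p" "\<And>n s t. linked ar V n s t \<Longrightarrow>
      chained ar V (Suc n) s (subst (quad s t t t) p)"
    using difference_step_term[OF assms] by blast
  obtain c where c: "wf_trm ar c" "projects V c" "chained ar V n (Var 0) (diag c)"
    using Suc.IH by blast
  have "\<exists>c. wf_trm ar c \<and> projects V c \<and> chained ar V (Suc n) (Var 0) (diag c)"
    if "chained ar V n (Var 0) v" "wf_trm ar w" "projects V w" "chained ar V (Suc n) (diag v) (diag w)"
    for v w
    using that
  proof (induction arbitrary: w rule: rtranclp_induct)
    case base
    then show ?case by auto
  next
    case (step v v')
    define w' where "w' = subst (quad v v' w w) p"
    have wf: "wf_trm ar v" "wf_trm ar v'" using step.hyps(2) unfolding linked_def by auto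
    have "projects V w'"
      unfolding projects_def
    proof (intro ballI allI impI)
      fix A and \<sigma> :: "nat \<Rightarrow> 'a" assume A: "A \<in> V" and \<sigma>: "range \<sigma> \<subseteq> carrier A" "\<sigma> 0 = \<sigma> 1"
      have "chained ar V n (Var 0) v'" using step.hyps by auto
      then have v: "eval_trm A \<sigma> v = \<sigma> 0" "eval_trm A \<sigma> v' = \<sigma> 0"
        using chained_collapse[OF _ A \<sigma>] step.hyps(1) by auto
      have w: "eval_trm A \<sigma> w = \<sigma> 2" using step.prems(2) A \<sigma> unfolding projects_def by blast
      have "range (quad (\<sigma> 0) (\<sigma> 0) (\<sigma> 2) (\<sigma> 2)) \<subseteq> carrier A" using \<sigma> by auto
      then show "eval_trm A \<sigma> w' = \<sigma> 2"
        using p(2) A unfolding w'_def eval_quad v w projects_def by fastforce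
    qed
    moreover have "wf_trm ar w'" unfolding w'_def using p(1) wf step.prems(1) by (intro wf_subst wf_quad)
    moreover have "chained ar V (Suc n) (diag v) (diag w')"
    proof -
      have "chained ar V (Suc n) (diag v) (subst (quad (diag v) (diag v') (diag v') (diag v')) p)"
        by (rule p(3)[OF linked_diag[OF step.hyps(2)]])
      moreover have "chained ar V (Suc n) (subst (quad (diag v) (diag v') (diag v') (diag v')) p)
          (subst (quad (diag v) (diag v') (diag w) (diag w)) p)"
        using step.prems(3) p(1) wf by (intro chained_third wf_subst wf_quad) auto
      ultimately show ?thesis unfolding w'_def subst_quad by (rule rtranclp_trans)
    qed
    ultimately show ?case by (intro step.IH)
  qed
  from this[OF c(3,1,2)] show ?case unfolding diag_diag by blast
qed

end

section \<open>Day terms from congruence modularity\<close>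

lemma map_eq_transfer:
  assumes "map g xs = map g ys" "\<And>x y. g x = g y \<Longrightarrow> h x = h y"
  shows "map h xs = map h ys"
  using assms(1)
proof (induction xs arbitrary: ys)
  case (Cons x xs)
  then obtain y zs where ys: "ys = y # zs" "g x = g y" "map g xs = map g zs" by (cases ys) auto
  show ?case using Cons.IH[OF ys(3)] assms(2)[OF ys(2)] by (simp add: ys(1))
qed simp

text \<open>In a free algebra with \<open>x, y, z, w\<close> among its generators, take the congruences \<open>\<alpha>\<close>
  generated by \<open>(y, z)\<close>, \<open>\<beta>\<close> by \<open>(x, y)\<close> and \<open>(z, w)\<close>, and \<open>\<gamma>\<close> by \<open>(x, w)\<close> and \<open>(y, z)\<close>. Then \<open>\<alpha> \<subseteq> \<gamma>\<close>, and \<open>(x, w)\<close> lies in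
  \<open>(\<alpha> \<or> \<beta>) \<inter> \<gamma>\<close>, hence by modularity in \<open>\<alpha> \<or> (\<beta> \<inter> \<gamma>)\<close>. The terms along a path of \<open>\<alpha>\<close>- and
  \<open>\<beta> \<inter> \<gamma>\<close>-steps from \<open>x\<close> to \<open>w\<close> are the Day terms: the path stays in the \<open>\<gamma>\<close>-class of \<open>x\<close>,
  and pairs in a congruence that is generated by variables are identities under the
  corresponding identification of variables.\<close>

lemma day_terms:
  fixes ar :: "'f \<Rightarrow> nat" and E :: "(('f, nat) trm \<times> ('f, nat) trm) set"
  defines "V \<equiv> variety ar E :: ('f, 'u) ualg set"
  assumes E: "\<And>s t. (s, t) \<in> E \<Longrightarrow> wf_trm ar s \<and> wf_trm ar t"
    and inf: "infinite (UNIV :: 'u set)" and inj: "\<exists>g :: 'f \<Rightarrow> 'u. inj g"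
    and mod: "congruence_modular ar V"
  shows "(day_step ar V)\<^sup>*\<^sup>* (Var 0) (Var 3)"
proof -
  have algebras: "is_algebra ar A" if "A \<in> V" for A
    using that unfolding V_def variety_def by blast
  define h where "h = (\<lambda>t :: ('f, nat) trm.
    {(A, \<sigma>, eval_trm A \<sigma> t) |A \<sigma>. A \<in> V \<and> range \<sigma> \<subseteq> carrier A})"
  obtain \<eta> :: "('f, nat) trm \<Rightarrow> 'u" where "\<forall>s t. \<eta> s = \<eta> t \<longleftrightarrow> h s = h t"
    using map_on_terms_embed[OF inf inj, of h] by (rule exE)
  moreover have "h s = h t \<longleftrightarrow> satisfies V s t" for s t
  proof
    assume st: "h s = h t"
    have "eval_trm A \<sigma> s = eval_trm A \<sigma> t" if "A \<in> V" "range \<sigma> \<subseteq> carrier A" for A \<sigma>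
    proof -
      have "(A, \<sigma>, eval_trm A \<sigma> s) \<in> h t" unfolding st[symmetric] unfolding h_def using that by simp
      then show ?thesis unfolding h_def by simp
    qed
    then show "satisfies V s t" unfolding satisfies_def by simp
  next
    assume "satisfies V s t"
    then show "h s = h t" unfolding h_def satisfies_def by auto
  qed
  ultimately have \<eta>: "\<eta> s = \<eta> t \<longleftrightarrow> satisfies V s t" for s t by simp
  have compat: "compatible ar \<eta>"
    unfolding compatible_def
  proof (intro allI impI)
    fix f ss ts assume "map \<eta> ss = map \<eta> ts"
    then have "map (eval_trm A \<sigma>) ss = map (eval_trm A \<sigma>) ts"
      if "A \<in> V" "range \<sigma> \<subseteq> carrier A" for A \<sigma>
      by (rule map_eq_transfer) (use that in \<open>auto simp: \<eta> satisfies_def\<close>)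
    then show "\<eta> (Fun f ss) = \<eta> (Fun f ts)" unfolding \<eta> satisfies_def by simp
  qed
  \<comment> \<open>The free algebra of countable rank, copied to \<open>'u\<close> so that modularity applies to it.\<close>
  define F where "F = term_quotient ar \<eta>"
  have F: "is_algebra ar F" unfolding F_def by (rule is_algebra_term_quotient[OF compat])
  have carrier_F: "carrier F = \<eta> ` wf_terms ar" unfolding F_def by simp
  have F_in: "F \<in> V"
    unfolding F_def V_def
  proof (rule term_quotient_in_variety[OF compat E])
    fix s t and \<tau> :: "nat \<Rightarrow> ('f, nat) trm"
    assume st: "(s, t) \<in> E" and \<tau>: "\<And>v. wf_trm ar (\<tau> v)"
    show "\<eta> (subst \<tau> s) = \<eta> (subst \<tau> t)"
      unfolding \<eta> satisfies_def eval_subst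
    proof (intro ballI allI impI)
      fix A and \<sigma> :: "nat \<Rightarrow> 'u" assume A: "A \<in> V" and \<sigma>: "range \<sigma> \<subseteq> carrier A"
      have "range (\<lambda>v. eval_trm A \<sigma> (\<tau> v)) \<subseteq> carrier A"
        by (rule range_eval[OF algebras[OF A] \<sigma> \<tau>])
      then show "eval_trm A (\<lambda>v. eval_trm A \<sigma> (\<tau> v)) s = eval_trm A (\<lambda>v. eval_trm A \<sigma> (\<tau> v)) t"
        using A st unfolding V_def variety_def by blast
    qed
  qed
  define gen where "gen R = cong_gen ar F {(\<eta> (Var i), \<eta> (Var j)) |i j. (i, j) \<in> R}" for R
  have collapse: "eval_trm A \<sigma> s = eval_trm A \<sigma> t"
    if A: "A \<in> V" and \<sigma>: "range \<sigma> \<subseteq> carrier A" and wf: "wf_trm ar s" "wf_trm ar t"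
      and st: "(\<eta> s, \<eta> t) \<in> gen R" and R: "\<forall>(i, j)\<in>R. \<sigma> i = \<sigma> j" for A \<sigma> s t R
  proof -
    have "eval_trm A \<sigma> s = eval_trm A \<sigma> t" if "\<eta> s = \<eta> t" for s t
      using that A \<sigma> unfolding \<eta> satisfies_def by blast
    then obtain \<phi> where hom: "is_hom ar F A \<phi>"
      and \<phi>: "\<And>t. wf_trm ar t \<Longrightarrow> \<phi> (\<eta> t) = eval_trm A \<sigma> t"
      using term_quotient_hom[OF compat algebras[OF A] \<sigma>] unfolding F_def by blast
    have in_F: "\<eta> (Var i) \<in> carrier F" for i unfolding carrier_F by simp
    have in_A: "\<phi> x \<in> carrier A" if "x \<in> carrier F" for x
      using hom that unfolding is_hom_def by blast
    have \<phi>_Var: "\<phi> (\<eta> (Var i)) = \<sigma> i" for i using \<phi>[of "Var i"] by simp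
    have "{(\<eta> (Var i), \<eta> (Var j)) |i j. (i, j) \<in> R} \<subseteq> pullback F \<phi> (Id_on (carrier A))"
    proof
      fix z assume "z \<in> {(\<eta> (Var i), \<eta> (Var j)) |i j. (i, j) \<in> R}"
      then obtain i j where z: "z = (\<eta> (Var i), \<eta> (Var j))" "(i, j) \<in> R" by blast
      then have "\<phi> (\<eta> (Var i)) = \<phi> (\<eta> (Var j))" using R unfolding \<phi>_Var by blast
      then show "z \<in> pullback F \<phi> (Id_on (carrier A))"
        using in_F in_A[OF in_F] unfolding z(1) pullback_def by (simp add: Id_on_iff)
    qed
    then have "(\<eta> s, \<eta> t) \<in> pullback F \<phi> (Id_on (carrier A))"
      using st unfolding gen_def using cong_gen_least[OF pullback_in_congruences[OF F hom Id_on_in_congruences[OF algebras[OF A]]]]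
      by blast
    then show ?thesis unfolding pullback_def using \<phi> wf by auto
  qed
  have gen: "gen R \<in> congruences ar F" for R
    unfolding gen_def carrier_F by (rule cong_gen_in_congruences[OF F]) (auto simp: carrier_F)
  have in_gen: "(\<eta> (Var i), \<eta> (Var j)) \<in> gen R" if "(i, j) \<in> R" for i j R
    using that cong_gen_incl[of "{(\<eta> (Var i), \<eta> (Var j)) |i j. (i, j) \<in> R}" ar F]
    unfolding gen_def by blast
  define \<alpha> where "\<alpha> = gen {(1, 2)}"
  define \<beta> where "\<beta> = gen {(0, 1), (2, 3)}"
  define \<gamma> where "\<gamma> = gen {(0, 3), (1, 2)}"
  have abc: "\<alpha> \<in> congruences ar F" "\<beta> \<in> congruences ar F" "\<gamma> \<in> congruences ar F"
    unfolding \<alpha>_def \<beta>_def \<gamma>_def by (rule gen)+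
  have \<alpha>\<gamma>: "\<alpha> \<subseteq> \<gamma>"
    unfolding \<alpha>_def gen_def
  proof (rule cong_gen_least[OF abc(3)])
    show "{(\<eta> (Var i), \<eta> (Var j)) |i j. (i, j) \<in> {(1, 2)}} \<subseteq> \<gamma>"
      using in_gen[of 1 2 "{(0, 3), (1, 2)}"] unfolding \<gamma>_def by auto
  qed
  have "(\<eta> (Var 0), \<eta> (Var 3)) \<in> cong_join ar F \<alpha> \<beta>"
    unfolding cong_join_def
  proof -
    let ?J = "cong_gen ar F (\<alpha> \<union> \<beta>)"
    have J: "?J \<in> congruences ar F"
      using congruence_carrier[OF abc(1)] congruence_carrier[OF abc(2)]
      by (intro cong_gen_in_congruences[OF F]) auto
    have sub: "\<alpha> \<union> \<beta> \<subseteq> ?J" by (rule cong_gen_incl)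
    have "(\<eta> (Var 0), \<eta> (Var 1)) \<in> ?J" "(\<eta> (Var 1), \<eta> (Var 2)) \<in> ?J" "(\<eta> (Var 2), \<eta> (Var 3)) \<in> ?J"
      using sub in_gen[of 0 1 "{(0, 1), (2, 3)}"] in_gen[of 2 3 "{(0, 1), (2, 3)}"] in_gen[of 1 2 "{(1, 2)}"]
      unfolding \<alpha>_def \<beta>_def by auto
    then show "(\<eta> (Var 0), \<eta> (Var 3)) \<in> ?J" using congruence_trans[OF J] by blast
  qed
  moreover have "(\<eta> (Var 0), \<eta> (Var 3)) \<in> \<gamma>"
    unfolding \<gamma>_def by (rule in_gen) simp
  moreover have "cong_join ar F \<alpha> (\<beta> \<inter> \<gamma>) = cong_join ar F \<alpha> \<beta> \<inter> \<gamma>"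
    using mod F_in abc \<alpha>\<gamma> unfolding congruence_modular_def by blast
  ultimately have join: "(\<eta> (Var 0), \<eta> (Var 3)) \<in> cong_gen ar F (\<alpha> \<union> \<beta> \<inter> \<gamma>)"
    unfolding cong_join_def by blast
  have int: "\<beta> \<inter> \<gamma> \<in> congruences ar F" using abc(2,3) by (rule congruences_Int)
  have "\<alpha> \<union> \<beta> \<inter> \<gamma> \<subseteq> (\<alpha> \<union> \<beta> \<inter> \<gamma>)\<^sup>* \<inter> carrier F \<times> carrier F"
    using congruence_carrier[OF abc(1)] congruence_carrier[OF int] by auto
  then have path: "(\<eta> (Var 0), \<eta> (Var 3)) \<in> (\<alpha> \<union> \<beta> \<inter> \<gamma>)\<^sup>*"
    using cong_gen_least[OF rtrancl_union_congruences[OF F abc(1) int]] join by blast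
  have absorbs: "absorbs V m" if "wf_trm ar m" "(\<eta> (Var 0), \<eta> m) \<in> \<gamma>" for m
    unfolding absorbs_def
  proof (intro ballI allI impI)
    fix A and \<sigma> :: "nat \<Rightarrow> 'u"
    assume "A \<in> V" "range \<sigma> \<subseteq> carrier A" "\<sigma> 0 = \<sigma> 3" "\<sigma> 1 = \<sigma> 2"
    then have "eval_trm A \<sigma> (Var 0) = eval_trm A \<sigma> m"
      using that unfolding \<gamma>_def by (intro collapse) auto
    then show "eval_trm A \<sigma> m = \<sigma> 0" by simp
  qed
  have day: "day_step ar V m m'"
    if wf: "wf_trm ar m" "wf_trm ar m'" and \<gamma>: "(\<eta> (Var 0), \<eta> m) \<in> \<gamma>" "(\<eta> (Var 0), \<eta> m') \<in> \<gamma>"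
      and mm': "(\<eta> m, \<eta> m') \<in> \<alpha> \<union> \<beta> \<inter> \<gamma>" for m m'
  proof -
    from mm' consider "(\<eta> m, \<eta> m') \<in> \<alpha>" | "(\<eta> m, \<eta> m') \<in> \<beta>" by blast
    then have "(\<forall>A\<in>V. \<forall>\<sigma>. range \<sigma> \<subseteq> carrier A \<longrightarrow> \<sigma> 1 = \<sigma> 2 \<longrightarrow> eval_trm A \<sigma> m = eval_trm A \<sigma> m') \<or>
      (\<forall>A\<in>V. \<forall>\<sigma>. range \<sigma> \<subseteq> carrier A \<longrightarrow> \<sigma> 0 = \<sigma> 1 \<longrightarrow> \<sigma> 2 = \<sigma> 3 \<longrightarrow>
       eval_trm A \<sigma> m = eval_trm A \<sigma> m')"
    proof cases
      case 1
      show ?thesis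
      proof (intro disjI1 ballI allI impI)
        fix A and \<sigma> :: "nat \<Rightarrow> 'u" assume "A \<in> V" "range \<sigma> \<subseteq> carrier A" "\<sigma> 1 = \<sigma> 2"
        then show "eval_trm A \<sigma> m = eval_trm A \<sigma> m'"
          using wf 1 unfolding \<alpha>_def by (intro collapse) auto
      qed
    next
      case 2
      show ?thesis
      proof (intro disjI2 ballI allI impI)
        fix A and \<sigma> :: "nat \<Rightarrow> 'u" assume "A \<in> V" "range \<sigma> \<subseteq> carrier A" "\<sigma> 0 = \<sigma> 1" "\<sigma> 2 = \<sigma> 3"
        then show "eval_trm A \<sigma> m = eval_trm A \<sigma> m'"
          using wf 2 unfolding \<beta>_def by (intro collapse) auto
      qed
    qed
    then show ?thesis using wf absorbs[OF wf(1) \<gamma>(1)] absorbs[OF wf(2) \<gamma>(2)]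
      unfolding day_step_def by blast
  qed
  have "\<exists>m. wf_trm ar m \<and> e = \<eta> m \<and> (day_step ar V)\<^sup>*\<^sup>* (Var 0) m \<and> (\<eta> (Var 0), e) \<in> \<gamma>"
    if "(\<eta> (Var 0), e) \<in> (\<alpha> \<union> \<beta> \<inter> \<gamma>)\<^sup>*" for e
    using that
  proof (induction rule: rtrancl_induct)
    case base
    have "\<eta> (Var 0) \<in> carrier F" unfolding carrier_F by simp
    then show ?case using congruence_refl[OF abc(3)] by (intro exI[of _ "Var 0"]) simp
  next
    case (step d e)
    then obtain m where m: "wf_trm ar m" "d = \<eta> m" "(day_step ar V)\<^sup>*\<^sup>* (Var 0) m" "(\<eta> (Var 0), d) \<in> \<gamma>"
      by blast
    have de: "(d, e) \<in> \<gamma>" using step.hyps(2) \<alpha>\<gamma> by blast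
    then have "e \<in> \<eta> ` wf_terms ar" using congruence_carrier[OF abc(3)] unfolding carrier_F by blast
    then obtain m' where m': "wf_trm ar m'" "e = \<eta> m'" by blast
    have e: "(\<eta> (Var 0), e) \<in> \<gamma>" using congruence_trans[OF abc(3) m(4) de] .
    have "day_step ar V m m'"
      using day[OF m(1) m'(1)] m(2,4) m'(2) e step.hyps(2) by blast
    with m(3) have "(day_step ar V)\<^sup>*\<^sup>* (Var 0) m'" by (rule rtranclp.rtrancl_into_rtrancl)
    then show ?case using m' e by blast
  qed
  from this[OF path] obtain m where m: "wf_trm ar m" "\<eta> (Var 3) = \<eta> m"
    "(day_step ar V)\<^sup>*\<^sup>* (Var 0) m" "(\<eta> (Var 0), \<eta> (Var 3)) \<in> \<gamma>" by blast
  have "(\<eta> m, \<eta> (Var 3)) \<in> \<alpha>" using m(1,2) congruence_refl[OF abc(1)] carrier_F by auto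
  then have "day_step ar V m (Var 3)" using m by (intro day) auto
  with m(3) show ?thesis by (rule rtranclp.rtrancl_into_rtrancl)
qed

section \<open>Change of carrier type and the theorem\<close>

lemma eval3_quad:
  assumes "vars c \<subseteq> {0, 1, 2}"
  shows "eval3 A c x y z = eval_trm A (quad x y z z) c"
  unfolding eval3_def using assms by (intro eval_cong) (auto simp: quad_def)

text \<open>A congruence \<open>\<delta>\<close> of \<open>A\<close> that satisfies the term condition restricts to one on the
  subalgebra generated by \<open>a\<close> and \<open>b\<close>, where \<open>c\<close> is known to be a difference term. The
  congruence generated by \<open>(a, b)\<close> in the subalgebra may be smaller than the restriction of the
  one in \<open>A\<close>, which only weakens the condition.\<close>

lemma difference_term_transfer:
  fixes ar :: "'f \<Rightarrow> nat" and E :: "(('f, nat) trm \<times> ('f, nat) trm) set"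
  assumes E: "\<And>s t. (s, t) \<in> E \<Longrightarrow> wf_trm ar s \<and> wf_trm ar t"
    and inf: "infinite (UNIV :: 'u set)" and inj: "\<exists>g :: 'f \<Rightarrow> 'u. inj g"
    and c: "n_difference_term ar (variety ar E :: ('f, 'u) ualg set) n c"
  shows "n_difference_term ar (variety ar E :: ('f, 'v) ualg set) n c"
proof -
  have wf: "wf_trm ar c" "vars c \<subseteq> {0, 1, 2}" using c unfolding n_difference_term_def by auto
  have "(eval3 A c a b b, a) \<in> higher_commutator ar A (replicate n (cong_gen ar A {(a, b)})) \<and>
      eval3 A c b b a = a"
    if A: "A \<in> variety ar E" and ab: "a \<in> carrier A" "b \<in> carrier A" for A :: "('f, 'v) ualg" and a b
  proof -
    have algA: "is_algebra ar A" using A unfolding variety_def by blast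
    define \<sigma> where "\<sigma> = quad a b b b"
    have \<sigma>: "range \<sigma> \<subseteq> carrier A" using ab unfolding \<sigma>_def by simp
    obtain \<eta> :: "('f, nat) trm \<Rightarrow> 'u" where \<eta>: "\<And>s t. \<eta> s = \<eta> t \<longleftrightarrow> eval_trm A \<sigma> s = eval_trm A \<sigma> t"
      using map_on_terms_embed[OF inf inj, of "eval_trm A \<sigma>"] by blast
    have compat: "compatible ar \<eta>"
      unfolding compatible_def
    proof (intro allI impI)
      fix f ss ts assume "map \<eta> ss = map \<eta> ts"
      then have "map (eval_trm A \<sigma>) ss = map (eval_trm A \<sigma>) ts"
        by (rule map_eq_transfer) (simp add: \<eta>)
      then show "\<eta> (Fun f ss) = \<eta> (Fun f ts)" unfolding \<eta> by simp
    qed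
    \<comment> \<open>A copy on \<open>'u\<close> of the subalgebra of \<open>A\<close> generated by \<open>a\<close> and \<open>b\<close>.\<close>
    define B where "B = term_quotient ar \<eta>"
    have B: "is_algebra ar B" unfolding B_def by (rule is_algebra_term_quotient[OF compat])
    have B_in: "B \<in> variety ar E"
      unfolding B_def
    proof (rule term_quotient_in_variety[OF compat E])
      fix s t and \<tau> :: "nat \<Rightarrow> ('f, nat) trm"
      assume st: "(s, t) \<in> E" and \<tau>: "\<And>v. wf_trm ar (\<tau> v)"
      have "range (\<lambda>v. eval_trm A \<sigma> (\<tau> v)) \<subseteq> carrier A" by (rule range_eval[OF algA \<sigma> \<tau>])
      then show "\<eta> (subst \<tau> s) = \<eta> (subst \<tau> t)"
        using A st unfolding \<eta> eval_subst variety_def by blast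
    qed
    obtain \<phi> where hom: "is_hom ar B A \<phi>"
      and \<phi>: "\<And>t. wf_trm ar t \<Longrightarrow> \<phi> (\<eta> t) = eval_trm A \<sigma> t"
      using term_quotient_hom[OF compat algA \<sigma>] \<eta> unfolding B_def by blast
    define a' where "a' = \<eta> (Var 0)"
    define b' where "b' = \<eta> (Var 1)"
    have ab': "a' \<in> carrier B" "b' \<in> carrier B" unfolding a'_def b'_def B_def by auto
    have \<phi>ab: "\<phi> a' = a" "\<phi> b' = b"
      using \<phi>[of "Var 0"] \<phi>[of "Var 1"] unfolding a'_def b'_def \<sigma>_def by auto
    have \<phi>_eval: "\<phi> (eval3 B c x y z) = eval3 A c (\<phi> x) (\<phi> y) (\<phi> z)"
      if "{x, y, z} \<subseteq> carrier B" for x y z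
      using hom_eval[OF B hom wf(1), of "quad x y z z"] that
      unfolding eval3_quad[OF wf(2)] quad_comp by (auto simp: quad_in)
    have cB: "(eval3 B c a' b' b', a') \<in> higher_commutator ar B (replicate n (cong_gen ar B {(a', b')}))"
      "eval3 B c b' b' a' = a'"
      using c B_in ab' unfolding n_difference_term_def by blast+
    have gen: "cong_gen ar B {(a', b')} \<subseteq> pullback B \<phi> (cong_gen ar A {(a, b)})"
      using cong_gen_pullback[OF B algA hom, of "{(a', b')}"] ab' \<phi>ab by simp
    have "(eval3 A c a b b, a) \<in> \<delta>" if \<delta>: "\<delta> \<in> congruences ar A"
      "centralizes ar A (replicate n (cong_gen ar A {(a, b)})) \<delta>" for \<delta>
    proof -
      have "(eval3 B c a' b' b', a') \<in> pullback B \<phi> \<delta>"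
        using cB(1) pullback_in_congruences[OF B hom \<delta>(1)] centralizes_pullback[OF B hom gen \<delta>(2)]
        unfolding higher_commutator_def by blast
      then have "(\<phi> (eval3 B c a' b' b'), \<phi> a') \<in> \<delta>" unfolding pullback_def by blast
      then show ?thesis using \<phi>_eval[of a' b' b'] ab' \<phi>ab by simp
    qed
    moreover have "eval3 A c b b a = a"
      using \<phi>_eval[of b' b' a'] ab' \<phi>ab cB(2) by simp
    ultimately show ?thesis unfolding higher_commutator_def by blast
  qed
  then show ?thesis unfolding n_difference_term_def using wf by blast
qed

theorem theorem4p11:
  fixes ar :: "'f \<Rightarrow> nat"
    and E :: "(('f, nat) trm \<times> ('f, nat) trm) set"
    and n :: nat
  assumes "\<And>s t. (s, t) \<in> E \<Longrightarrow> wf_trm ar s \<and> wf_trm ar t"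
    and "infinite (UNIV :: 'u set)"
    and "\<exists>g :: 'f \<Rightarrow> 'u. inj g"
    and "congruence_modular ar (variety ar E :: ('f, 'u) ualg set)"
    and "n \<ge> 2"
  shows "(\<exists>c. n_difference_term ar (variety ar E :: ('f, 'u) ualg set) n c) \<and>
    (\<forall>c. n_difference_term ar (variety ar E :: ('f, 'u) ualg set) n c \<longrightarrow>
         n_difference_term ar (variety ar E :: ('f, 'v) ualg set) n c)"
proof (intro conjI allI impI)
  let ?V = "variety ar E :: ('f, 'u) ualg set"
  have algebras: "\<forall>A\<in>?V. is_algebra ar A" unfolding variety_def by blast
  obtain k where n: "n = Suc k" using assms(5) by (cases n) auto
  have "(day_step ar ?V)\<^sup>*\<^sup>* (Var 0) (Var 3)" using assms(1-4) by (rule day_terms)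
  then obtain d where d: "wf_trm ar d" "projects ?V d" "chained ar ?V k (Var 0) (diag d)"
    using difference_terms[OF algebras] by blast
  define c :: "('f, nat) trm" where "c = subst (quad (Var 0) (Var 1) (Var 2) (Var 2)) d"
  have "wf_trm ar c" unfolding c_def using d(1) by (intro wf_subst wf_quad) auto
  moreover have vars: "vars c \<subseteq> {0, 1, 2}" unfolding c_def by (auto simp: vars_subst quad_def split: if_splits)
  moreover have "(eval3 A c a b b, a) \<in> higher_commutator ar A (replicate n (cong_gen ar A {(a, b)}))"
    "eval3 A c b b a = a" if A: "A \<in> ?V" and ab: "a \<in> carrier A" "b \<in> carrier A" for A a b
  proof -
    have eval: "eval3 A c x y z = eval_trm A (quad x y z z) d" for x y z
      unfolding eval3_quad[OF vars] unfolding c_def eval_quad by simp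
    have "range (quad a b b b) \<subseteq> carrier A" using ab by simp
    from chained_commutator[OF algebras d(3) A this]
    show "(eval3 A c a b b, a) \<in> higher_commutator ar A (replicate n (cong_gen ar A {(a, b)}))"
      unfolding n eval eval_quad by simp
    have "range (quad b b a a) \<subseteq> carrier A" using ab by simp
    then show "eval3 A c b b a = a" using d(2) A unfolding eval projects_def by fastforce
  qed
  ultimately show "\<exists>c. n_difference_term ar ?V n c" unfolding n_difference_term_def by blast
next
  fix c assume c: "n_difference_term ar (variety ar E :: ('f, 'u) ualg set) n c"
  show "n_difference_term ar (variety ar E :: ('f, 'v) ualg set) n c"
    using assms(1-3) c by (rule difference_term_transfer)
qed

end
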